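(* Let $n$ be an even positive integer and let $Q_n$ be a random $n\times n$ matrix with entries in $\{0,1\}$ whose rows are independent random vectors, each chosen uniformly at random from the set of all $(0,1)$-vectors in $\mathbb{R}^n$ having exactly $n/2$ zero components. Then for every constant $C>0$, $$\mathbb{P}(Q_n \text{ is singular}) = O(n^{-C}),$$ where the implied constant depends only on $C$. *)

theory Defs
  imports "HOL-Probability.Product_PMF" "Jordan_Normal_Form.Matrix"
begin

unbundle no vec_syntax
hide_const (open) Finite_Cartesian_Product.vec Finite_Cartesian_Product.mat

definition balanced_vecs :: "nat \<Rightarrow> real vec set" where
  "balanced_vecs n =
     {v \<in> carrier_vec n. (\<forall>i<n. v $ i \<in> {0, 1}) \<and> card {i. i < n \<and> v $ i = 0} = n div 2}"

text \<open>
  The rows are the coordinates of a product distribution, hence independent; the value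
  \<^term>\<open>0\<^sub>v n\<close> is only the padding that \<^const>\<open>Pi_pmf\<close> uses outside the index set.
\<close>

definition random_balanced_matrix :: "nat \<Rightarrow> real mat pmf" where
  "random_balanced_matrix n =
     map_pmf (mat\<^sub>r n n) (Pi_pmf {..<n} (0\<^sub>v n) (\<lambda>_. pmf_of_set (balanced_vecs n)))"

text \<open>\<^const>\<open>pmf_of_set\<close> is meaningful only on finite nonempty sets.\<close>

lemma finite_balanced_vecs: "finite (balanced_vecs n)"
proof -
  have "balanced_vecs n \<subseteq> (\<lambda>f. vec n f) ` ({..<n} \<rightarrow>\<^sub>E {0, 1})"
  proof
    fix v assume v: "v \<in> balanced_vecs n"
    have "v = vec n (restrict (($) v) {..<n})"
      using v by (auto simp: balanced_vecs_def)
    moreover have "restrict (($) v) {..<n} \<in> {..<n} \<rightarrow>\<^sub>E {0, 1}"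
      using v by (auto simp: balanced_vecs_def)
    ultimately show "v \<in> (\<lambda>f. vec n f) ` ({..<n} \<rightarrow>\<^sub>E {0, 1})" by blast
  qed
  then show ?thesis by (rule finite_subset) (intro finite_imageI finite_PiE; simp)
qed

lemma balanced_vecs_nonempty: "balanced_vecs n \<noteq> {}"
proof -
  let ?v = "vec n (\<lambda>i. if i < n div 2 then 0 else 1) :: real vec"
  have "{i. i < n \<and> ?v $ i = 0} = {..<n div 2}"
    by (auto split: if_splits)
  then have "?v \<in> balanced_vecs n" by (auto simp: balanced_vecs_def)
  then show ?thesis by blast
qed

end

theory Submission
  imports Defs "HOL-Number_Theory.Cong" "HOL-Real_Asymp.Real_Asymp" "Jordan_Normal_Form.Determinant"
begin

text \<open>
  Fix a prime \<open>p\<close> of polynomial size. If \<open>Q\<close> is singular, some row is a combination of the others,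
  hence is orthogonal modulo \<open>p\<close> to a nonzero vector \<open>a\<close> that depends only on the other \<open>n - 1\<close> rows.
  Either a random row is orthogonal to \<open>a\<close> with probability \<open>\<rho>(a) \<le> n\<^sup>-\<^sup>C\<close>, and independence of the
  last row finishes the proof, or \<open>a\<close> is exceptional, and it suffices that the sum of
  \<open>\<rho>(a)^(n - 1)\<close> over exceptional \<open>a\<close> is tiny. For \<open>a\<close> constant up to about \<open>sqrt n\<close> coordinates this
  is a direct count. For all others a Halasz-type argument shows that, for every large set \<open>b\<close> of
  coordinates, \<open>\<rho>(a)\<close> is by a power of \<open>n\<close> smaller than the density of the solutions of
  \<open>a(i1) - a(j1) + \<dots> + a(ik) - a(jk) = 0\<close> with indices in \<open>b\<close>. Such solutions determine coordinates
  of \<open>a\<close> from the remaining ones, up to few choices; removing one coordinate after the other, in the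
  spirit of Ferber, Jain, Luh and Samotij, bounds the number of exceptional vectors.
\<close>

section \<open>Exponential sums\<close>

text \<open>All sizes result from competing losses. The bound for \<open>rho\<close> carries an
  error of order \<open>1 / p\<close>, so \<open>p\<close> must be larger than \<open>n^C\<close>;
  yet the \<open>m = k * q\<close> coordinates left after peeling are counted trivially, at cost
  \<open>p^m\<close>. Each peeled coordinate gains a factor of order \<open>1 / sqrt M\<close>,
  where \<open>M\<close> is the height, in units of \<open>2 * n\<close>, of the level set on which
  exponential sums are compared with solution densities. A power of \<open>n\<close> has to be
  gained, so \<open>M\<close> is a power of \<open>n\<close>. The comparison needs blocks with
  \<open>2 * M * n \<le> q^2\<close>, while \<open>m\<close> has to be small against
  \<open>n\<close>; and the roughly \<open>(n * p)^M\<close> vectors with at most \<open>M\<close>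
  deviating coordinates are paid for by \<open>(3 / 4)^(n - 1)\<close>. With \<open>M\<close> about
  \<open>sqrt n\<close> and \<open>q\<close> about \<open>n^(3/4)\<close> all of this holds for any
  \<open>p\<close> of polynomial size. High powers of \<open>rho\<close> appear because
  \<open>n - 1\<close> independent rows must be orthogonal to the same vector.\<close>

definition ep :: "nat \<Rightarrow> int \<Rightarrow> complex" where
  "ep q x = cis (2 * pi * real_of_int x / real q)"

lemma norm_ep [simp]: "norm (ep q x) = 1"
  by (simp add: ep_def)

lemma ep_0 [simp]: "ep q 0 = 1"
  by (simp add: ep_def)

lemma ep_add: "ep q (x + y) = ep q x * ep q y"
  by (simp add: ep_def cis_mult ring_distribs add_divide_distrib)

lemma cnj_ep: "cnj (ep q x) = ep q (- x)"
  by (simp add: ep_def cis_cnj)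

lemma ep_diff: "ep q (x - y) = ep q x * cnj (ep q y)"
  using ep_add[of q x "- y"] by (simp add: cnj_ep)

lemma ep_sum: "finite A \<Longrightarrow> ep q (\<Sum>i\<in>A. f i) = (\<Prod>i\<in>A. ep q (f i))"
  by (induction A rule: finite_induct) (auto simp: ep_add)

lemma ep_power: "ep q x ^ k = ep q (int k * x)"
  unfolding ep_def Complex.DeMoivre by (simp add: mult_ac)

lemma ep_eq_1_iff:
  assumes "q > 0"
  shows "ep q x = 1 \<longleftrightarrow> int q dvd x"
proof
  assume "ep q x = 1"
  then have "cos (2 * pi * real_of_int x / real q) = 1"
    by (simp add: ep_def complex_eq_iff)
  then obtain k :: int where "2 * pi * real_of_int x / real q = of_int k * 2 * pi"
    by (auto simp: cos_one_2pi_int)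
  then have "real_of_int x = of_int (k * int q)"
    using assms by (simp add: field_simps)
  then show "int q dvd x" by (metis dvd_triv_right of_int_eq_iff)
next
  assume "int q dvd x"
  then obtain k where "x = int q * k" by blast
  then have "ep q x = cis (2 * pi * of_int k)" using assms by (simp add: ep_def mult.assoc)
  also have "\<dots> = 1" by (rule cis_multiple_2pi) (rule Ints_of_int)
  finally show "ep q x = 1" .
qed

lemma ep_cong: "q > 0 \<Longrightarrow> int q dvd x - y \<Longrightarrow> ep q x = ep q y"
  by (metis ep_add ep_eq_1_iff diff_add_cancel mult_1)

lemma sum_ep:
  assumes "q > 0"
  shows "(\<Sum>t\<in>{0..<int q}. ep q (t * x)) = (if int q dvd x then of_nat q else 0)"
proof -
  have *: "(\<Sum>t\<in>{0..<int q}. ep q (t * x)) = (\<Sum>t<q. ep q x ^ t)"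
    by (rule sum.reindex_bij_witness[of _ int nat]) (auto simp: ep_power)
  have "ep q x ^ q = 1"
    using assms by (simp add: ep_power ep_eq_1_iff)
  then show ?thesis unfolding *
    using ep_eq_1_iff[OF assms, of x] geometric_sum[of "ep q x" q] by auto
qed

section \<open>The exponential sum of a coordinate set and its deficit\<close>

definition expsum :: "nat \<Rightarrow> nat set \<Rightarrow> (nat \<Rightarrow> int) \<Rightarrow> int \<Rightarrow> complex" where
  "expsum p b a t = (\<Sum>j\<in>b. ep p (t * a j))"

text \<open>By \<open>spread_eq\<close> this is twice the deficit \<open>|b|^2 - |expsum|^2\<close>.
  Written as a sum of squared distances it is visibly monotone in \<open>b\<close>, and its square
  root is an L2 norm, hence subadditive in \<open>t\<close>; neither property can be read off from
  the deficit.\<close>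

definition spread :: "nat \<Rightarrow> nat set \<Rightarrow> (nat \<Rightarrow> int) \<Rightarrow> int \<Rightarrow> real" where
  "spread p b a t = (\<Sum>(i, j)\<in>b \<times> b. (cmod (ep p (t * a i) - ep p (t * a j)))\<^sup>2)"

lemma cmod_diff_unit:
  assumes "cmod z = 1" "cmod w = 1"
  shows "(cmod (z - w))\<^sup>2 = 2 - 2 * Re (z * cnj w)"
proof -
  have "(Re z)\<^sup>2 + (Im z)\<^sup>2 = 1" "(Re w)\<^sup>2 + (Im w)\<^sup>2 = 1"
    using assms by (simp_all flip: cmod_power2)
  then show ?thesis
    unfolding cmod_power2 by (simp add: power2_eq_square algebra_simps)
qed

lemma spread_eq:
  assumes "finite b"
  shows "spread p b a t = 2 * ((real (card b))\<^sup>2 - (cmod (expsum p b a t))\<^sup>2)"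
proof -
  have "(cmod (expsum p b a t))\<^sup>2 = Re (expsum p b a t * cnj (expsum p b a t))"
    by (metis Re_complex_of_real complex_norm_square)
  also have "expsum p b a t * cnj (expsum p b a t) =
      (\<Sum>(i, j)\<in>b \<times> b. ep p (t * a i) * cnj (ep p (t * a j)))"
    by (simp add: expsum_def sum_product sum.cartesian_product)
  finally have "(cmod (expsum p b a t))\<^sup>2 =
      (\<Sum>(i, j)\<in>b \<times> b. Re (ep p (t * a i) * cnj (ep p (t * a j))))"
    by (simp add: case_prod_unfold)
  moreover have "spread p b a t =
      (\<Sum>(i, j)\<in>b \<times> b. 2 - 2 * Re (ep p (t * a i) * cnj (ep p (t * a j))))"
    unfolding spread_def by (intro sum.cong) (auto simp: cmod_diff_unit)
  ultimately show ?thesis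
    by (simp add: case_prod_unfold sum_subtractf sum_distrib_left card_cartesian_product
        power2_eq_square)
qed

lemma spread_nonneg: "spread p b a t \<ge> 0"
  unfolding spread_def by (intro sum_nonneg) auto

lemma spread_mono: "finite b' \<Longrightarrow> b \<subseteq> b' \<Longrightarrow> spread p b a t \<le> spread p b' a t"
  unfolding spread_def by (intro sum_mono2) auto

text \<open>For unit numbers \<open>|z w - z' w'| \<le> |z - z'| + |w - w'|\<close>, and Minkowski's
  inequality does the rest. Subadditivity is what \<open>level_set_growth\<close> feeds on.\<close>

lemma sqrt_spread_add:
  "sqrt (spread p b a (s + t)) \<le> sqrt (spread p b a s) + sqrt (spread p b a t)"
proof -
  let ?f = "\<lambda>t (i, j). cmod (ep p (t * a i) - ep p (t * a j))"
  have eq: "sqrt (spread p b a t) = L2_set (?f t) (b \<times> b)" for t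
    by (simp add: spread_def L2_set_def case_prod_unfold)
  have "?f (s + t) x \<le> ?f s x + ?f t x" for x
  proof (cases x)
    case (Pair i j)
    have "ep p ((s + t) * a i) - ep p ((s + t) * a j) =
        (ep p (s * a i) - ep p (s * a j)) * ep p (t * a i)
        + ep p (s * a j) * (ep p (t * a i) - ep p (t * a j))"
      by (simp add: ep_add algebra_simps)
    also have "cmod \<dots> \<le> cmod (ep p (s * a i) - ep p (s * a j)) + cmod (ep p (t * a i) - ep p (t * a j))"
      by (rule order.trans[OF norm_triangle_ineq]) (simp add: norm_mult)
    finally show ?thesis using Pair by simp
  qed
  then have "L2_set (?f (s + t)) (b \<times> b) \<le> L2_set (\<lambda>x. ?f s x + ?f t x) (b \<times> b)"
    by (intro L2_set_mono) (auto simp: case_prod_unfold)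
  also have "\<dots> \<le> L2_set (?f s) (b \<times> b) + L2_set (?f t) (b \<times> b)"
    by (rule L2_set_triangle_ineq)
  finally show ?thesis by (simp add: eq)
qed

lemma spread_uminus: "spread p b a (- t) = spread p b a t"
proof -
  have "cmod (ep p (- t * a i) - ep p (- t * a j)) = cmod (ep p (t * a i) - ep p (t * a j))" for i j
    by (metis cnj_ep complex_cnj_diff complex_mod_cnj minus_mult_left)
  then show ?thesis by (simp add: spread_def)
qed

lemma spread_0 [simp]: "spread p b a 0 = 0"
  by (simp add: spread_def)

lemma spread_cong: "p > 0 \<Longrightarrow> int p dvd s - t \<Longrightarrow> spread p b a s = spread p b a t"
proof -
  assume "p > 0" "int p dvd s - t"
  then have "ep p (s * x) = ep p (t * x)" for x
    by (intro ep_cong) (auto simp flip: left_diff_distrib)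
  then show ?thesis by (simp add: spread_def)
qed

text \<open>The normalised coefficient \<open>w q\<close> satisfies
  \<open>w (q + 1) = w q * (2 q + 1) / (2 q + 2)\<close>. Hence \<open>w^2 * (2 q + 1)\<close>
  decreases from 1 at \<open>q = 0\<close>, and \<open>4 q * w^2\<close> increases from 1 at
  \<open>q = 1\<close>.\<close>

lemma central_binomial_upper: "(real ((2*q) choose q) / 4^q)\<^sup>2 * (2 * real q + 1) \<le> 1"
  and central_binomial_lower: "q > 0 \<Longrightarrow> 1 \<le> 4 * real q * (real ((2*q) choose q) / 4^q)\<^sup>2"
proof -
  define w where "w q = real ((2*q) choose q) / 4^q" for q
  have w_Suc: "w (Suc q) = w q * ((2 * real q + 1) / (2 * real q + 2))" for q
  proof -
    have "(Suc q) * ((2 * Suc q) choose Suc q) = (2 * Suc q) * (Suc (2 * q) choose q)"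
      by (metis binomial_absorption mult_Suc_right add_2_eq_Suc diff_Suc_1)
    moreover have "Suc q * (Suc (2*q) choose q) = Suc (2*q) * ((2*q) choose q)"
      using binomial_absorb_comp[of "Suc (2*q)" q] by (simp add: Suc_diff_le)
    ultimately have "real (Suc q) * (real (Suc q) * real ((2 * Suc q) choose Suc q)) =
        real (2 * Suc q) * (real (Suc (2*q)) * real ((2*q) choose q))"
      by (metis (no_types, lifting) mult.left_commute of_nat_mult)
    then have "(real q + 1)\<^sup>2 * real ((2 * Suc q) choose Suc q) =
        (real q + 1) * (2 * ((2 * real q + 1) * real ((2*q) choose q)))"
      by (simp add: power2_eq_square algebra_simps del: binomial_Suc_Suc mult_Suc_right)
    then have "(real q + 1) * real ((2 * Suc q) choose Suc q) = 2 * ((2 * real q + 1) * real ((2*q) choose q))"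
      by (simp only: power2_eq_square mult.assoc mult_cancel_left) auto
    then have "real ((2 * Suc q) choose Suc q) = real ((2*q) choose q) * (2 * (2 * real q + 1) / (real q + 1))"
      by (simp add: eq_divide_eq mult_ac del: binomial_Suc_Suc mult_Suc_right)
    then show ?thesis
      unfolding w_def by (simp add: divide_simps del: binomial_Suc_Suc mult_Suc_right) (simp add: algebra_simps del: binomial_Suc_Suc mult_Suc_right)
  qed
  have "(w q)\<^sup>2 * (2 * real q + 1) \<le> 1" for q
  proof (induction q)
    case 0 then show ?case by (simp add: w_def)
  next
    case (Suc q)
    have "(w (Suc q))\<^sup>2 * (2 * real (Suc q) + 1) =
       ((w q)\<^sup>2 * (2 * real q + 1)) * ((2 * real q + 1) * (2 * real q + 3) / (2 * real q + 2)\<^sup>2)"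
      unfolding w_Suc by (simp add: power2_eq_square field_simps)
    also have "\<dots> \<le> 1 * 1"
    proof (intro mult_mono Suc)
      have "(2 * real q + 1) * (2 * real q + 3) \<le> (2 * real q + 2)\<^sup>2"
        by (simp add: power2_eq_square algebra_simps)
      then show "(2 * real q + 1) * (2 * real q + 3) / (2 * real q + 2)\<^sup>2 \<le> 1"
        by (simp add: divide_le_eq_1)
    qed auto
    finally show ?case by simp
  qed
  then show "(real ((2*q) choose q) / 4^q)\<^sup>2 * (2 * real q + 1) \<le> 1" by (simp add: w_def)
  have "1 \<le> 4 * real (Suc q) * (w (Suc q))\<^sup>2" for q
  proof (induction q)
    case 0 then show ?case by (simp add: w_def power2_eq_square)
  next
    case (Suc q)
    have "1 * 1 \<le> (4 * real (Suc q) * (w (Suc q))\<^sup>2) *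
        ((2 * real (Suc q) + 1)\<^sup>2 / (4 * real (Suc q) * (real (Suc q) + 1)))"
    proof (intro mult_mono Suc)
      have "4 * real (Suc q) * (real (Suc q) + 1) \<le> (2 * real (Suc q) + 1)\<^sup>2"
        by (simp add: power2_eq_square algebra_simps)
      then show "1 \<le> (2 * real (Suc q) + 1)\<^sup>2 / (4 * real (Suc q) * (real (Suc q) + 1))"
        by (simp add: le_divide_eq_1 del: of_nat_Suc)
    qed auto
    also have "\<dots> = 4 * real (Suc (Suc q)) * (w (Suc (Suc q)))\<^sup>2"
      unfolding w_Suc[of "Suc q"] by (simp add: power2_eq_square divide_simps) (simp add: algebra_simps)
    finally show ?case by simp
  qed
  then show "q > 0 \<Longrightarrow> 1 \<le> 4 * real q * (real ((2*q) choose q) / 4^q)\<^sup>2"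
    by (metis w_def Suc_pred)
qed

section \<open>Concentration on the slice\<close>

text \<open>A row is encoded by its set of ones, which has \<open>n div 2\<close> elements because
  \<open>n\<close> is even; \<open>bij_betw_ones\<close> makes the translation.\<close>

definition slice :: "nat \<Rightarrow> nat set set" where
  "slice n = {S. S \<subseteq> {..<n} \<and> card S = n div 2}"

definition rho :: "nat \<Rightarrow> nat \<Rightarrow> (nat \<Rightarrow> int) \<Rightarrow> real" where
  "rho p n a = real (card {S \<in> slice n. int p dvd sum a S}) / real (card (slice n))"

lemma finite_slice [simp]: "finite (slice n)"
  by (rule finite_subset[of _ "Pow {..<n}"]) (auto simp: slice_def)

lemma card_slice: "card (slice n) = n choose (n div 2)"
  using n_subsets[of "{..<n}" "n div 2"] by (simp add: slice_def)

text \<open>For a unit number \<open>x\<close> one has \<open>|1 + x|^2 = (1 + x)^2 * cnj x\<close>,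
  so the summand is a Laurent polynomial in \<open>ep N u\<close> with exponents between
  \<open>-q\<close> and \<open>q\<close>. As \<open>q < N\<close>, summing over all
  \<open>N\<close>-th roots of unity leaves only the constant term.\<close>

lemma sum_power_one_plus_unit:
  assumes z: "cmod z = 1" and N: "q < N"
  shows "(\<Sum>u\<in>{0..<int N}. cmod (1 + z * ep N u) ^ (2 * q)) = real N * real ((2 * q) choose q)"
proof -
  have unit: "of_real (cmod (1 + x) ^ (2 * q)) = (1 + x) ^ (2 * q) * cnj x ^ q" if "cmod x = 1" for x
  proof -
    have x: "x * cnj x = 1" using that by (simp flip: complex_norm_square)
    have "of_real ((cmod (1 + x))\<^sup>2) = (1 + x) * (x * cnj x + cnj x)"
      unfolding x complex_norm_square by simp
    also have "\<dots> = (1 + x)\<^sup>2 * cnj x" by (simp add: power2_eq_square algebra_simps)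
    finally have "of_real ((cmod (1 + x))\<^sup>2) ^ q = ((1 + x)\<^sup>2 * cnj x) ^ q" by simp
    then show ?thesis by (simp add: power_mult power_mult_distrib)
  qed
  have expand: "of_real (cmod (1 + z * ep N u) ^ (2 * q)) =
      (\<Sum>j\<le>2*q. of_nat ((2*q) choose j) * z ^ j * cnj z ^ q * ep N (u * (int j - int q)))" for u
  proof -
    have "of_real (cmod (1 + z * ep N u) ^ (2 * q)) =
        (z * ep N u + 1) ^ (2 * q) * cnj (z * ep N u) ^ q"
      using unit[of "z * ep N u"] z by (simp add: norm_mult add.commute)
    also have "\<dots> = (\<Sum>j\<le>2*q. of_nat ((2*q) choose j) * (z * ep N u) ^ j * cnj (z * ep N u) ^ q)"
      unfolding binomial_ring by (simp add: sum_distrib_right)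
    also have "\<dots> = (\<Sum>j\<le>2*q. of_nat ((2*q) choose j) * z ^ j * cnj z ^ q * ep N (u * (int j - int q)))"
      by (intro sum.cong) (auto simp: power_mult_distrib ep_power cnj_ep ring_distribs ep_diff mult_ac)
    finally show ?thesis .
  qed
  have "complex_of_real (\<Sum>u\<in>{0..<int N}. cmod (1 + z * ep N u) ^ (2 * q)) =
     (\<Sum>u\<in>{0..<int N}. \<Sum>j\<le>2*q. of_nat ((2*q) choose j) * z ^ j * cnj z ^ q * ep N (u * (int j - int q)))"
    by (simp add: expand del: of_real_power)
  also have "\<dots> = (\<Sum>j\<le>2*q. of_nat ((2*q) choose j) * z ^ j * cnj z ^ q *
       (\<Sum>u\<in>{0..<int N}. ep N (u * (int j - int q))))"
    by (subst sum.swap) (simp add: sum_distrib_left)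
  also have "\<dots> = (\<Sum>j\<le>2*q. if j = q then of_nat ((2*q) choose q) * of_nat N else 0)"
  proof (intro sum.cong refl)
    fix j assume j: "j \<in> {..2*q}"
    have "int N dvd int j - int q \<longleftrightarrow> j = q"
    proof
      assume "int N dvd int j - int q"
      moreover have "\<bar>int j - int q\<bar> < int N" using j N by auto
      ultimately have "int j - int q = 0" using zdvd_imp_le[of "int N" "\<bar>int j - int q\<bar>"] by fastforce
      then show "j = q" by simp
    qed auto
    moreover have "z ^ q * cnj z ^ q = 1"
      using z by (simp flip: power_mult_distrib complex_norm_square)
    ultimately show "of_nat ((2*q) choose j) * z ^ j * cnj z ^ q *
       (\<Sum>u\<in>{0..<int N}. ep N (u * (int j - int q))) =
       (if j = q then of_nat ((2*q) choose q) * of_nat N else 0)"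
      using N by (simp add: sum_ep mult.assoc)
  qed
  also have "\<dots> = complex_of_real (real N * real ((2 * q) choose q))"
    by simp
  finally show ?thesis using of_real_eq_iff by blast
qed

text \<open>Two orthogonality relations: the modulus \<open>p\<close> detects the condition on
  \<open>sum a S\<close>, and the modulus \<open>N = n + 1\<close>, which exceeds every
  \<open>|card S - n div 2|\<close>, detects the size of \<open>S\<close>. The sum over all subsets
  then factors over the coordinates.\<close>

lemma slice_count_le:
  assumes p: "p > 0" and N: "N = Suc n"
  shows "real (card {S \<in> slice n. int p dvd sum a S}) * (real p * real N) \<le>
    (\<Sum>t\<in>{0..<int p}. \<Sum>u\<in>{0..<int N}. \<Prod>j<n. cmod (1 + ep p (t * a j) * ep N u))"
proof -
  let ?h = "n div 2"
  have "N > 0" using N by simp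
  have ind: "(if int N dvd int (card S) - int ?h then complex_of_nat N else 0) =
      (if card S = ?h then of_nat N else 0)" if "S \<subseteq> {..<n}" for S
  proof -
    have "card S \<le> n" using card_mono[OF _ that] by simp
    then have "\<bar>int (card S) - int ?h\<bar> < int N" using N by linarith
    then have "int N dvd int (card S) - int ?h \<longleftrightarrow> card S = ?h"
      using zdvd_imp_le[of "int N" "\<bar>int (card S) - int ?h\<bar>"] by fastforce
    then show ?thesis by simp
  qed
  have inner: "(\<Sum>S\<in>Pow {..<n}. ep p (t * sum a S) * ep N (u * (int (card S) - int ?h))) =
     ep N (- u * int ?h) * (\<Prod>j<n. 1 + ep p (t * a j) * ep N u)" for t u
  proof -
    have "ep p (t * sum a S) * ep N (u * (int (card S) - int ?h)) =
        ep N (- u * int ?h) * (\<Prod>j\<in>S. ep p (t * a j) * ep N u)" if "S \<subseteq> {..<n}" for S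
    proof -
      have "finite S" using that finite_subset by blast
      moreover have "u * (int (card S) - int ?h) = int (card S) * u + (- u * int ?h)"
        by (simp add: algebra_simps)
      ultimately show ?thesis
        by (simp only: ep_add) (simp add: sum_distrib_left ep_sum prod.distrib ep_power)
    qed
    then have "(\<Sum>S\<in>Pow {..<n}. ep p (t * sum a S) * ep N (u * (int (card S) - int ?h))) =
      (\<Sum>S\<in>Pow {..<n}. ep N (- u * int ?h) * (\<Prod>j\<in>S. ep p (t * a j) * ep N u))"
      by (intro sum.cong) auto
    also have "\<dots> = ep N (- u * int ?h) * (\<Prod>j<n. ep p (t * a j) * ep N u + 1)"
      by (simp add: prod_add sum_distrib_left)
    finally show ?thesis by (simp add: add.commute)
  qed
  have "complex_of_real (real (card {S \<in> slice n. int p dvd sum a S}) * (real p * real N)) =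
     (\<Sum>S\<in>{S \<in> slice n. int p dvd sum a S}. of_nat p * of_nat N)"
    by simp
  also have "\<dots> = (\<Sum>S\<in>Pow {..<n}. (if int p dvd sum a S then of_nat p else 0) *
      (if int N dvd int (card S) - int ?h then of_nat N else 0))"
  proof -
    have "(\<Sum>S\<in>Pow {..<n}. (if int p dvd sum a S then of_nat p else 0) *
      (if int N dvd int (card S) - int ?h then of_nat N else 0)) =
      (\<Sum>S\<in>Pow {..<n}. if int p dvd sum a S \<and> card S = ?h then complex_of_nat p * of_nat N else 0)"
      by (intro sum.cong refl) (auto simp: ind split: if_splits)
    also have "\<dots> = (\<Sum>S\<in>{S \<in> slice n. int p dvd sum a S}. of_nat p * of_nat N)"
      by (intro sum.mono_neutral_cong_right) (auto simp: slice_def)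
    finally show ?thesis by simp
  qed
  also have "\<dots> = (\<Sum>S\<in>Pow {..<n}. (\<Sum>t\<in>{0..<int p}. ep p (t * sum a S)) *
      (\<Sum>u\<in>{0..<int N}. ep N (u * (int (card S) - int ?h))))"
    using p \<open>N > 0\<close> by (simp add: sum_ep)
  also have "\<dots> = (\<Sum>t\<in>{0..<int p}. \<Sum>u\<in>{0..<int N}.
      \<Sum>S\<in>Pow {..<n}. ep p (t * sum a S) * ep N (u * (int (card S) - int ?h)))"
    unfolding sum_product by (rule trans[OF sum.swap]) (rule sum.cong[OF refl sum.swap])
  also have "\<dots> = (\<Sum>t\<in>{0..<int p}. \<Sum>u\<in>{0..<int N}.
      ep N (- u * int ?h) * (\<Prod>j<n. 1 + ep p (t * a j) * ep N u))"
    by (simp add: inner)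
  finally have eq: "complex_of_real (real (card {S \<in> slice n. int p dvd sum a S}) * (real p * real N)) =
    (\<Sum>t\<in>{0..<int p}. \<Sum>u\<in>{0..<int N}.
      ep N (- u * int ?h) * (\<Prod>j<n. 1 + ep p (t * a j) * ep N u))" .
  have "real (card {S \<in> slice n. int p dvd sum a S}) * (real p * real N) =
    cmod (complex_of_real (real (card {S \<in> slice n. int p dvd sum a S}) * (real p * real N)))"
    unfolding norm_of_real by simp
  also have "\<dots> \<le> (\<Sum>t\<in>{0..<int p}. \<Sum>u\<in>{0..<int N}.
      cmod (ep N (- u * int ?h) * (\<Prod>j<n. 1 + ep p (t * a j) * ep N u)))"
    unfolding eq by (intro order.trans[OF norm_sum] sum_mono order.refl)
  finally show ?thesis by (simp add: norm_mult prod_norm)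
qed

lemma cmod_one_plus_unit_le:
  assumes "cmod z = 1"
  shows "cmod (1 + z) \<le> 2 * exp (- (1 - Re z) / 4)"
proof -
  have "(Re z)\<^sup>2 + (Im z)\<^sup>2 = 1" using assms by (simp flip: cmod_power2)
  then have "(cmod (1 + z))\<^sup>2 = 4 * (1 + (- (1 - Re z) / 2))"
    unfolding cmod_power2 by (simp add: power2_eq_square field_simps)
  also have "\<dots> \<le> 4 * exp (- (1 - Re z) / 2)"
    by (intro mult_left_mono exp_ge_add_one_self) auto
  also have "\<dots> = (2 * exp (- (1 - Re z) / 4))\<^sup>2"
    by (simp add: power_mult_distrib flip: exp_double)
  finally show ?thesis by (rule power2_le_imp_le) simp
qed

text \<open>
  One square root of the product supplies the exponential decay; the other is averaged over the
  unit circle by Hoelder's inequality, and exactly compensates the normalisation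
  \<open>(n choose n/2) / 2^n\<close> of the slice.
\<close>
lemma sum_prod_one_plus_unit_le:
  fixes z :: "nat \<Rightarrow> complex"
  assumes z: "\<And>j. j < n \<Longrightarrow> cmod (z j) = 1" and n: "n > 0" "even n" and N: "N = Suc n"
    and q: "q = n div 2 div 2"
  shows "(\<Sum>u\<in>{0..<int N}. \<Prod>j<n. cmod (1 + z j * ep N u)) \<le>
    2 ^ n * exp (- (real n - cmod (\<Sum>j<n. z j)) / 8) * (real N * (real ((2 * q) choose q) / 4 ^ q))"
proof -
  let ?A = "\<Sum>j<n. z j"
  define y where "y u j = cmod (1 + z j * ep N u) / 2" for u j
  have y: "0 \<le> y u j" "y u j \<le> 1" if "j < n" for u j
  proof -
    have "cmod (1 + z j * ep N u) \<le> 1 + cmod (z j * ep N u)"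
      using norm_triangle_ineq[of 1 "z j * ep N u"] by simp
    then show "y u j \<le> 1" using z[OF that] by (simp add: y_def norm_mult)
  qed (simp add: y_def)
  have decay: "(\<Prod>j<n. y u j) \<le> exp (- (real n - cmod ?A) / 4)" for u
  proof -
    have "(\<Prod>j<n. y u j) \<le> (\<Prod>j<n. exp (- (1 - Re (z j * ep N u)) / 4))"
    proof (intro prod_mono conjI)
      fix j assume "j \<in> {..<n}"
      then show "y u j \<le> exp (- (1 - Re (z j * ep N u)) / 4)"
        using cmod_one_plus_unit_le[of "z j * ep N u"] z by (simp add: y_def norm_mult)
    qed (use y in auto)
    also have "\<dots> = exp (\<Sum>j<n. - (1 - Re (z j * ep N u)) / 4)"
      by (simp add: exp_sum)
    also have "(\<Sum>j<n. - (1 - Re (z j * ep N u)) / 4) = - (real n - Re (?A * ep N u)) / 4"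
      by (simp add: sum_subtractf sum_distrib_right flip: sum_divide_distrib)
    also have "exp \<dots> \<le> exp (- (real n - cmod ?A) / 4)"
      using complex_Re_le_cmod[of "?A * ep N u"] by (simp add: norm_mult)
    finally show ?thesis .
  qed
  \<comment> \<open>Hoelder's inequality in the guise of the AM-GM inequality for the numbers
    \<open>y u j ^ (n div 2)\<close>, whose geometric mean is the square root of the product. As
    \<open>n div 2\<close> may be odd, the exponent is lowered to the even number
    \<open>2 * q\<close>, which is allowed since \<open>0 \<le> y u j \<le> 1\<close>.\<close>
  have amgm: "sqrt (\<Prod>j<n. y u j) \<le> (\<Sum>j<n. y u j ^ (2 * q) / real n)" for u
  proof -
    have "(\<Prod>j<n. y u j ^ (n div 2)) powr (1 / real n) \<le> (\<Sum>j<n. y u j ^ (n div 2) / real n)"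
      using arith_geom_mean[of "{..<n}" "\<lambda>j. y u j ^ (n div 2)"] n y by auto
    also have "\<dots> \<le> (\<Sum>j<n. y u j ^ (2 * q) / real n)"
      using y q by (intro sum_mono divide_right_mono power_decreasing) auto
    also have "(\<Prod>j<n. y u j ^ (n div 2)) powr (1 / real n) = sqrt (\<Prod>j<n. y u j)"
    proof -
      let ?P = "\<Prod>j<n. y u j"
      have P: "?P \<ge> 0" using y by (intro prod_nonneg) auto
      have "(\<Prod>j<n. y u j ^ (n div 2)) = ?P ^ (n div 2)" by (simp add: prod_power_distrib)
      also have "\<dots> powr (1 / real n) = sqrt ?P"
      proof (cases "?P = 0")
        case True
        have "n div 2 > 0" using n by (auto elim: evenE)
        then show ?thesis unfolding True by simp
      next
        case False
        then have "?P > 0" using P by linarith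
        then have "?P ^ (n div 2) = ?P powr (real n / 2)"
          using n(2) by (subst powr_realpow[symmetric]) (auto simp: real_of_nat_div)
        then show ?thesis using \<open>?P > 0\<close> n by (simp add: powr_powr powr_half_sqrt)
      qed
      finally show ?thesis .
    qed
    finally show ?thesis .
  qed
  have "(\<Sum>u\<in>{0..<int N}. \<Prod>j<n. cmod (1 + z j * ep N u)) = 2 ^ n * (\<Sum>u\<in>{0..<int N}. \<Prod>j<n. y u j)"
    by (simp add: y_def prod_dividef sum_distrib_left)
  also have "(\<Sum>u\<in>{0..<int N}. \<Prod>j<n. y u j) \<le>
      (\<Sum>u\<in>{0..<int N}. exp (- (real n - cmod ?A) / 8) * (\<Sum>j<n. y u j ^ (2 * q) / real n))"
  proof (intro sum_mono)
    fix u
    have P: "(\<Prod>j<n. y u j) \<ge> 0" using y by (intro prod_nonneg) auto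
    have "exp (- (real n - cmod ?A) / 4) = (exp (- (real n - cmod ?A) / 8))\<^sup>2"
      by (simp flip: exp_double)
    then have "sqrt (\<Prod>j<n. y u j) \<le> exp (- (real n - cmod ?A) / 8)"
      using decay[of u] by (simp add: real_le_lsqrt)
    then have "sqrt (\<Prod>j<n. y u j) * sqrt (\<Prod>j<n. y u j) \<le>
      exp (- (real n - cmod ?A) / 8) * (\<Sum>j<n. y u j ^ (2 * q) / real n)"
      using P by (intro mult_mono amgm) auto
    then show "(\<Prod>j<n. y u j) \<le> exp (- (real n - cmod ?A) / 8) * (\<Sum>j<n. y u j ^ (2 * q) / real n)"
      using P by simp
  qed
  also have "\<dots> = exp (- (real n - cmod ?A) / 8) * (\<Sum>j<n. (\<Sum>u\<in>{0..<int N}. y u j ^ (2 * q)) / real n)"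
    unfolding sum_distrib_left[symmetric] by (subst sum.swap) (simp add: sum_divide_distrib)
  also have "(\<Sum>j<n. (\<Sum>u\<in>{0..<int N}. y u j ^ (2 * q)) / real n) =
      (\<Sum>j<n. real N * (real ((2 * q) choose q) / 4 ^ q) / real n)"
  proof (intro sum.cong refl)
    fix j assume "j \<in> {..<n}"
    then have "(\<Sum>u\<in>{0..<int N}. cmod (1 + z j * ep N u) ^ (2 * q)) = real N * real ((2 * q) choose q)"
      using z q N by (intro sum_power_one_plus_unit) auto
    then show "(\<Sum>u\<in>{0..<int N}. y u j ^ (2 * q)) / real n = real N * (real ((2 * q) choose q) / 4 ^ q) / real n"
      by (simp add: y_def power_divide power_mult flip: sum_divide_distrib)
  qed
  also have "\<dots> = real N * (real ((2 * q) choose q) / 4 ^ q)" using n by simp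
  finally show ?thesis by (simp add: mult_ac)
qed

text \<open>The averaged half of the product contributes \<open>wq\<close> and the size of the slice
  contributes \<open>wh\<close>; both are of order \<open>1 / sqrt n\<close>, so no power of
  \<open>n\<close> is lost. The constant 32 is 8 times 4: with \<open>A\<close> the modulus of the
  exponential sum, \<open>spread = 2 * (n^2 - A^2) \<le> 4 * n * (n - A)\<close>.\<close>

lemma rho_le_sum_exp:
  assumes p: "p > 0" and n: "n > 0" "even n"
  shows "rho p n a \<le> 2 / real p * (\<Sum>t\<in>{0..<int p}. exp (- spread p {..<n} a t / (32 * real n)))"
proof -
  define h q where "h = n div 2" and "q = h div 2"
  define wh wq where "wh = real ((2*h) choose h) / 4^h" and "wq = real ((2*q) choose q) / 4^q"
  have h: "n = 2 * h" "h > 0" using n by (auto simp: h_def)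
  have pos: "wh > 0" "wq > 0" by (auto simp: wh_def wq_def)
  have "wq \<le> 2 * wh"
  proof (rule power2_le_imp_le)
    have "wq\<^sup>2 * real h \<le> wq\<^sup>2 * (2 * real q + 1)"
      unfolding q_def by (intro mult_left_mono) auto
    also have "\<dots> \<le> 1" unfolding wq_def by (rule central_binomial_upper)
    also have "\<dots> \<le> 4 * real h * wh\<^sup>2" unfolding wh_def by (rule central_binomial_lower) fact
    finally show "wq\<^sup>2 \<le> (2 * wh)\<^sup>2" using h by (simp add: power_mult_distrib field_simps)
  qed (use pos in auto)
  have decay: "exp (- (real n - cmod (expsum p {..<n} a t)) / 8) \<le> exp (- spread p {..<n} a t / (32 * real n))" for t
  proof -
    let ?A = "cmod (expsum p {..<n} a t)"
    have "?A \<le> (\<Sum>j<n. cmod (ep p (t * a j)))" unfolding expsum_def by (rule norm_sum)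
    then have A: "?A \<le> real n" by simp
    have "spread p {..<n} a t = 2 * ((real n - ?A) * (real n + ?A))"
      by (simp add: spread_eq power2_eq_square algebra_simps)
    also have "\<dots> \<le> 2 * ((real n - ?A) * (2 * real n))"
      using A by (intro mult_left_mono) auto
    finally show ?thesis using n by (simp add: field_simps)
  qed
  let ?Z = "real (card {S \<in> slice n. int p dvd sum a S})"
  have "?Z * (real p * real (Suc n)) \<le>
    (\<Sum>t\<in>{0..<int p}. \<Sum>u\<in>{0..<int (Suc n)}. \<Prod>j<n. cmod (1 + ep p (t * a j) * ep (Suc n) u))"
    by (rule slice_count_le) (use p in auto)
  also have "\<dots> \<le> (\<Sum>t\<in>{0..<int p}. 2 ^ n * exp (- spread p {..<n} a t / (32 * real n)) * (real (Suc n) * wq))"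
  proof (intro sum_mono)
    fix t
    have "(\<Sum>u\<in>{0..<int (Suc n)}. \<Prod>j<n. cmod (1 + ep p (t * a j) * ep (Suc n) u)) \<le>
      2 ^ n * exp (- (real n - cmod (expsum p {..<n} a t)) / 8) * (real (Suc n) * wq)"
      unfolding expsum_def wq_def by (rule sum_prod_one_plus_unit_le) (use n in \<open>auto simp: q_def h_def\<close>)
    also have "\<dots> \<le> 2 ^ n * exp (- spread p {..<n} a t / (32 * real n)) * (real (Suc n) * wq)"
      using pos by (intro mult_right_mono mult_left_mono decay) auto
    finally show "(\<Sum>u\<in>{0..<int (Suc n)}. \<Prod>j<n. cmod (1 + ep p (t * a j) * ep (Suc n) u)) \<le> \<dots>" .
  qed
  also have "\<dots> = real (Suc n) * (2 ^ n * wq * (\<Sum>t\<in>{0..<int p}. exp (- spread p {..<n} a t / (32 * real n))))"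
    by (simp add: sum_distrib_left mult_ac del: of_nat_Suc)
  finally have "real (Suc n) * (?Z * real p) \<le>
      real (Suc n) * (2 ^ n * wq * (\<Sum>t\<in>{0..<int p}. exp (- spread p {..<n} a t / (32 * real n))))"
    by (simp add: mult_ac del: of_nat_Suc)
  then have "?Z * real p \<le> 2 ^ n * wq * (\<Sum>t\<in>{0..<int p}. exp (- spread p {..<n} a t / (32 * real n)))"
    by (simp del: of_nat_Suc)
  also have "\<dots> \<le> 2 ^ n * (2 * wh) * (\<Sum>t\<in>{0..<int p}. exp (- spread p {..<n} a t / (32 * real n)))"
    using \<open>wq \<le> 2 * wh\<close> by (intro mult_right_mono mult_left_mono sum_nonneg) auto
  also have "2 ^ n * (2 * wh) = 2 * real (card (slice n))"
    by (simp add: card_slice wh_def h power_mult)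
  finally show ?thesis
    using p pos unfolding rho_def by (simp add: field_simps card_slice zero_less_binomial_iff)
qed

section \<open>Growth of level sets\<close>

text \<open>
  A substitute for the Cauchy--Davenport theorem: walking along the multiples of a small nonzero
  element, one meets points \<open>s j\<close> at distance about \<open>3 j y\<close>, and the translates of the level set
  of \<open>y\<close> by these points are disjoint.
\<close>
lemma level_set_growth:
  fixes f :: "int \<Rightarrow> real"
  assumes p: "prime p" and y: "y \<ge> 0"
    and sub: "\<And>s t. f (s + t) \<le> f s + f t" and sym: "\<And>t. f (- t) = f t" and zero: "f 0 = 0"
    and per: "\<And>s t. int p dvd s - t \<Longrightarrow> f s = f t"
    and big: "f z > 3 * real l * y"
  shows "l * card {t \<in> {0..<int p}. f t \<le> y} \<le> l + card {t \<in> {0..<int p}. f t \<le> 3 * real l * y}"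
proof (cases "\<exists>g\<in>{0<..<int p}. f g \<le> y")
  case False
  \<comment> \<open>The level set is at most \<open>{0}\<close>; the summand \<open>l\<close> on the
    right-hand side pays for this case.\<close>
  then have "{t \<in> {0..<int p}. f t \<le> y} \<subseteq> {0}" by force
  then have "card {t \<in> {0..<int p}. f t \<le> y} \<le> card {0 :: int}" by (intro card_mono) auto
  then have "card {t \<in> {0..<int p}. f t \<le> y} \<le> 1" by simp
  then have "l * card {t \<in> {0..<int p}. f t \<le> y} \<le> l * 1" by (rule mult_le_mono2)
  then show ?thesis by linarith
next
  case True
  then obtain g where g: "0 < g" "g < int p" "f g \<le> y" by auto
  have p0: "p > 0" using p prime_gt_0_nat by blast
  let ?T = "{t \<in> {0..<int p}. f t \<le> y}"
  have "coprime g (int p)"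
    using p g zdvd_not_zless by (metis coprime_commute prime_imp_coprime prime_nat_int_transfer)
  then obtain g' where g': "[g * g' = 1] (mod int p)" using cong_solve_coprime_int by blast
  \<comment> \<open>As \<open>g\<close> is invertible modulo \<open>p\<close>, its multiples reach
    every residue. The multiple with index \<open>i0\<close> is \<open>z\<close>, so the walk does
    leave all the levels considered.\<close>
  define i0 where "i0 = nat ((g' * z) mod int p)"
  have "[int i0 * g = (g' * z) * g] (mod int p)"
    unfolding i0_def using p0 by (intro cong_scalar_right) (simp add: cong_def)
  also have "(g' * z) * g = (g * g') * z" by (simp add: mult_ac)
  also have "[(g * g') * z = 1 * z] (mod int p)" by (intro cong_scalar_right g')
  finally have "f (int i0 * g) = f z" by (intro per) (simp add: cong_iff_dvd_diff)
  then have i0: "f (int i0 * g) > 3 * real l * y" using big by simp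
  \<comment> \<open>Take the first multiple of \<open>g\<close> above height
    \<open>(3 j - 1) y\<close>: one step raises \<open>f\<close> by at most
    \<open>f g \<le> y\<close>, so it is still at height at most \<open>3 j y\<close>.\<close>
  have "\<exists>s. f s \<le> 3 * real j * y \<and> (j > 0 \<longrightarrow> f s > (3 * real j - 1) * y)" if j: "j < l" for j
  proof (cases "j = 0")
    case True then show ?thesis using zero by (intro exI[of _ 0]) auto
  next
    case False
    let ?P = "\<lambda>i. f (int i * g) > (3 * real j - 1) * y"
    define i where "i = (LEAST i. ?P i)"
    have "(3 * real j - 1) * y \<le> 3 * real l * y" using j y by (intro mult_right_mono) auto
    then have "?P i0" using i0 by linarith
    then have i: "?P i" unfolding i_def by (rule LeastI)
    have "i \<noteq> 0"
    proof
      assume "i = 0"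
      moreover have "(3 * real j - 1) * y \<ge> 0" using False y by (intro mult_nonneg_nonneg) auto
      ultimately show False using i zero by simp
    qed
    then obtain i' where i': "i = Suc i'" using not0_implies_Suc by blast
    then have "\<not> ?P i'" unfolding i_def using not_less_Least by (metis i_def lessI)
    moreover have "f (int i * g) \<le> f (int i' * g) + f g"
      using sub[of "int i' * g" g] by (simp add: i' algebra_simps)
    ultimately have "f (int i * g) \<le> 3 * real j * y" using g(3) by (simp add: algebra_simps)
    then show ?thesis using i by blast
  qed
  then obtain s where s: "\<And>j. j < l \<Longrightarrow> f (s j) \<le> 3 * real j * y"
      "\<And>j. j < l \<Longrightarrow> j > 0 \<Longrightarrow> f (s j) > (3 * real j - 1) * y"
    by metis
  define F where "F = (\<lambda>(j, t). (s j + t) mod int p)"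
  have cong: "int p dvd s j + t - (s j' + t')" if "F (j, t) = F (j', t')" for j t j' t'
    using that by (simp add: F_def mod_eq_dvd_iff)
  \<comment> \<open>Two elements of the level set bridge a height of at most \<open>2 y\<close>, but
    \<open>s j'\<close> lies above \<open>(3 j' - 1) y \<ge> 3 j y + 2 y\<close>.\<close>
  have no: False if "F (j, t) = F (j', t')" "j < j'" "j' < l" "t \<in> ?T" "t' \<in> ?T" for j j' t t'
  proof -
    have "int p dvd s j' - (s j + t - t')"
      using cong[OF that(1)] by (metis (no_types, opaque_lifting) add_diff_eq diff_diff_eq2 dvd_diff_commute diff_add_eq)
    then have "f (s j') = f (s j + t + - t')" by (intro per) simp
    also have "\<dots> \<le> f (s j) + f t + f t'"
      using sub[of "s j + t" "- t'"] sub[of "s j" t] sym[of t'] by linarith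
    also have "\<dots> \<le> 3 * real j * y + y + y" using that s(1)[of j] by auto
    also have "\<dots> = (3 * (real j + 1) - 1) * y" by (simp add: algebra_simps)
    also have "\<dots> \<le> (3 * real j' - 1) * y" using that y by (intro mult_right_mono) auto
    finally show False using s(2)[of j'] that by simp
  qed
  have "inj_on F ({..<l} \<times> ?T)"
  proof (rule inj_onI)
    fix x x' assume *: "x \<in> {..<l} \<times> ?T" "x' \<in> {..<l} \<times> ?T" "F x = F x'"
    obtain j t j' t' where x: "x = (j, t)" "x' = (j', t')" by fastforce
    have "j = j'" using no[of j t j' t'] no[of j' t' j t] *
      unfolding x by (cases j j' rule: linorder_cases) auto
    then have "int p dvd t - t'" using cong * x by fastforce
    then have "t mod int p = t' mod int p" by (simp add: mod_eq_dvd_iff)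
    then have "t = t'" using * x by auto
    then show "x = x'" using \<open>j = j'\<close> x by simp
  qed
  then have "card ({..<l} \<times> ?T) \<le> card {t \<in> {0..<int p}. f t \<le> 3 * real l * y}"
  proof (rule card_inj_on_le)
    show "F ` ({..<l} \<times> ?T) \<subseteq> {t \<in> {0..<int p}. f t \<le> 3 * real l * y}"
    proof (rule image_subsetI)
      fix x assume "x \<in> {..<l} \<times> ?T"
      then obtain j t where x: "x = (j, t)" and *: "j \<in> {..<l}" "t \<in> {0..<int p}" "f t \<le> y"
        by fastforce
      have "f (F (j, t)) = f (s j + t)"
        by (intro per) (simp add: F_def mod_eq_dvd_iff[symmetric])
      also have "\<dots> \<le> 3 * real j * y + y" using sub[of "s j" t] s(1)[of j] * by auto
      also have "\<dots> = (3 * real j + 1) * y" by (simp add: algebra_simps)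
      also have "\<dots> \<le> 3 * real l * y" using * y by (intro mult_right_mono) auto
      finally show "F x \<in> {t \<in> {0..<int p}. f t \<le> 3 * real l * y}"
        using p0 by (simp add: F_def x)
    qed
    show "finite {t \<in> {0..<int p}. f t \<le> 3 * real l * y}"
      by (rule finite_subset[of _ "{0..<int p}"]) auto
  qed
  then show ?thesis by (simp add: card_cartesian_product)
qed

section \<open>Level sets of the spread and summation over them\<close>

definition low_spread :: "nat \<Rightarrow> nat set \<Rightarrow> (nat \<Rightarrow> int) \<Rightarrow> real \<Rightarrow> int set" where
  "low_spread p b a x = {t \<in> {0..<int p}. spread p b a t \<le> x}"

lemma finite_low_spread [simp]: "finite (low_spread p b a x)"
  unfolding low_spread_def by (rule finite_subset[of _ "{0..<int p}"]) auto

text \<open>This is \<open>level_set_growth\<close> for the square root of \<open>spread\<close>,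
  with \<open>l\<close> the integer part of \<open>u = sqrt (X / x) / 3\<close>, so that
  \<open>3 * l * sqrt x \<le> sqrt X\<close>. Rounding costs a factor 2, which turns
  \<open>3 * sqrt (x / X)\<close> into the constant 6; for \<open>u < 1\<close> the right-hand side
  exceeds the trivial bound.\<close>

lemma card_low_spread_le:
  assumes p: "prime p" and x: "0 < x" "x \<le> X" and big: "spread p b a z > X"
  shows "real (card (low_spread p b a x)) \<le> 1 + 6 * sqrt (x / X) * real (card (low_spread p b a X))"
proof -
  let ?T = "low_spread p b a"
  define u where "u = sqrt (X / x) / 3"
  have X: "X > 0" using x by linarith
  have r: "sqrt (x / X) = 1 / (3 * u)" by (simp add: u_def real_sqrt_divide)
  have u0: "u > 0" using x X by (simp add: u_def)
  show ?thesis
  proof (cases "u < 1")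
    case True
    have "real (card (?T x)) \<le> real (card (?T X))"
      using x by (intro of_nat_mono card_mono finite_low_spread) (auto simp: low_spread_def)
    also have "real (card (?T X)) \<le> (6 * sqrt (x / X)) * real (card (?T X))"
    proof -
      have "1 \<le> 6 * sqrt (x / X)" using True u0 by (simp add: r field_simps)
      then show ?thesis using mult_right_mono[of 1 "6 * sqrt (x / X)" "real (card (?T X))"] by simp
    qed
    finally show ?thesis by simp
  next
    case False
    define l where "l = nat \<lfloor>u\<rfloor>"
    have l: "real l \<le> u" "real l \<ge> u / 2" "l > 0" 
    proof -
      have "1 \<le> \<lfloor>u\<rfloor>" "u < \<lfloor>u\<rfloor> + 1" using False by simp_all
      then show "real l \<le> u" "real l \<ge> u / 2" "l > 0" unfolding l_def by linarith+
    qed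
    have "3 * real l * sqrt x \<le> 3 * u * sqrt x" using l x by (intro mult_right_mono) auto
    also have "\<dots> = sqrt X" using x by (simp add: u_def real_sqrt_divide)
    finally have le: "3 * real l * sqrt x \<le> sqrt X" .
    have "l * card {t \<in> {0..<int p}. sqrt (spread p b a t) \<le> sqrt x} \<le>
        l + card {t \<in> {0..<int p}. sqrt (spread p b a t) \<le> 3 * real l * sqrt x}"
    proof (rule level_set_growth[OF p, where z = z])
      show "sqrt (spread p b a z) > 3 * real l * sqrt x"
        using big le real_sqrt_less_mono by (meson order.strict_trans1)
    next
      show "sqrt (spread p b a s) = sqrt (spread p b a t)" if "int p dvd s - t" for s t
        using spread_cong that p prime_gt_0_nat by metis
    qed (use x in \<open>auto simp: sqrt_spread_add spread_uminus\<close>)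
    also have "card {t \<in> {0..<int p}. sqrt (spread p b a t) \<le> 3 * real l * sqrt x} \<le> card (?T X)"
      using le by (intro card_mono finite_low_spread) (auto simp: low_spread_def dest: order.trans)
    also have "{t \<in> {0..<int p}. sqrt (spread p b a t) \<le> sqrt x} = ?T x"
      by (auto simp: low_spread_def)
    finally have "real (l * card (?T x)) \<le> real (l + card (?T X))" by (simp only: of_nat_le_iff)
    then have "real (card (?T x)) \<le> 1 + real (card (?T X)) / real l"
      using l by (simp add: field_simps)
    also have "\<dots> \<le> 1 + real (card (?T X)) / (u / 2)"
      using l u0 by (intro add_left_mono divide_left_mono) auto
    also have "\<dots> = 1 + 6 * sqrt (x / X) * real (card (?T X))" by (simp add: r)
    finally show ?thesis .
  qed
qed

text \<open>Total weight of the layers in \<open>sum_exp_spread_le\<close>: residues first captured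
  at height \<open>2 * (x + 1) * n\<close> have exponential at most \<open>exp (- x / 16)\<close>,
  and \<open>x + 1\<close> comes from the bound on their number.\<close>

definition layer_const :: real where
  "layer_const = (\<Sum>x. (real x + 1) * exp (- real x / 16))"

lemma summable_layer: "summable (\<lambda>x. (real x + 1) * exp (- real x / 16))"
proof -
  have e: "exp (- real x / 16) = exp (- 1 / 16 :: real) ^ x" for x
    by (simp flip: exp_of_nat_mult)
  have "summable (\<lambda>x. of_nat (Suc x) * exp (- 1 / 16 :: real) ^ x)"
    by (rule sums_summable, rule geometric_deriv_sums) simp
  then show ?thesis unfolding e by (simp add: add.commute)
qed

lemma layer_const_pos: "layer_const > 0"
  unfolding layer_const_def using summable_layer by (intro suminf_pos) auto

text \<open>Layer-cake summation with layers of width \<open>2 * n\<close>. Below height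
  \<open>2 * M * n\<close> every level set is smaller than the one at that height by a factor of
  about \<open>sqrt ((x + 1) / M)\<close>, which produces Halasz's gain \<open>1 / sqrt M\<close>;
  residues above that height contribute at most \<open>exp (- M / 16)\<close> each.\<close>

lemma sum_exp_spread_le:
  assumes p: "prime p" and n: "n > 0" and M: "M > 0" and big: "spread p b a z > 2 * real M * real n"
  shows "(\<Sum>t\<in>{0..<int p}. exp (- spread p b a t / (32 * real n))) \<le>
    layer_const * (1 + 6 * real (card (low_spread p b a (2 * real M * real n))) / sqrt (real M))
    + real p * exp (- real M / 16)"
proof -
  let ?U = "\<lambda>x. low_spread p b a (2 * real (Suc x) * real n)"
  let ?T = "low_spread p b a (2 * real M * real n)"
  let ?e = "\<lambda>x. exp (- real x / 16)"
  define c where "c = 6 * real (card ?T) / sqrt (real M)"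
  have "(\<Sum>t\<in>{0..<int p}. exp (- spread p b a t / (32 * real n))) \<le>
    (\<Sum>t\<in>{0..<int p}. (\<Sum>x<M. if t \<in> ?U x then ?e x else 0) + ?e M)"
  proof (intro sum_mono)
    fix t assume t: "t \<in> {0..<int p}"
    let ?s = "spread p b a t"
    show "exp (- ?s / (32 * real n)) \<le> (\<Sum>x<M. if t \<in> ?U x then ?e x else 0) + ?e M"
    proof (cases "?s \<le> 2 * real M * real n")
      case False
      then have "exp (- ?s / (32 * real n)) \<le> ?e M" using n by (simp add: field_simps)
      also have "\<dots> \<le> (\<Sum>x<M. if t \<in> ?U x then ?e x else 0) + ?e M" by (simp add: sum_nonneg)
      finally show ?thesis .
    next
      case True
      define x where "x = (LEAST x. ?s \<le> 2 * real (Suc x) * real n)"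
      have M1: "?s \<le> 2 * real (Suc (M - 1)) * real n" using True M by simp
      have x: "?s \<le> 2 * real (Suc x) * real n" unfolding x_def by (rule LeastI) (rule M1)
      have "x \<le> M - 1" unfolding x_def by (rule Least_le) (rule M1)
      then have "x < M" using M by linarith
      have "?s \<ge> 2 * real x * real n"
      proof (cases x)
        case 0 then show ?thesis by (simp add: spread_nonneg)
      next
        case (Suc x')
        then have "\<not> ?s \<le> 2 * real (Suc x') * real n"
          using not_less_Least[of x' "\<lambda>x. ?s \<le> 2 * real (Suc x) * real n"] by (simp add: x_def)
        then show ?thesis using Suc by simp
      qed
      then have "exp (- ?s / (32 * real n)) \<le> ?e x" using n by (simp add: field_simps)
      also have "\<dots> = (if t \<in> ?U x then ?e x else 0)" using x t by (simp add: low_spread_def)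
      also have "\<dots> \<le> (\<Sum>x<M. if t \<in> ?U x then ?e x else 0)"
        using \<open>x < M\<close> by (intro member_le_sum) auto
      finally show ?thesis by (simp add: add_increasing2)
    qed
  qed
  also have "\<dots> = (\<Sum>x<M. \<Sum>t\<in>{0..<int p}. if t \<in> ?U x then ?e x else 0) + real p * ?e M"
    by (simp add: sum.distrib) (rule sum.swap)
  also have "(\<Sum>x<M. \<Sum>t\<in>{0..<int p}. if t \<in> ?U x then ?e x else 0) = (\<Sum>x<M. real (card (?U x)) * ?e x)"
  proof (intro sum.cong refl)
    fix x
    have "(\<Sum>t\<in>{0..<int p}. if t \<in> ?U x then ?e x else 0) = (\<Sum>t\<in>?U x. ?e x)"
      by (intro sum.mono_neutral_cong_right) (auto simp: low_spread_def)
    then show "(\<Sum>t\<in>{0..<int p}. if t \<in> ?U x then ?e x else 0) = real (card (?U x)) * ?e x" by simp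
  qed
  also have "\<dots> \<le> (\<Sum>x<M. ((real x + 1) * (1 + c)) * ?e x)"
  proof (intro sum_mono mult_right_mono)
    fix x assume "x \<in> {..<M}"
    then have xM: "real (Suc x) \<le> real M" by simp
    have c0: "c \<ge> 0" by (simp add: c_def)
    have "real (card (?U x)) \<le> 1 + 6 * sqrt ((2 * real (Suc x) * real n) / (2 * real M * real n)) * real (card ?T)"
      using n xM big by (intro card_low_spread_le[OF p]) auto
    also have "(2 * real (Suc x) * real n) / (2 * real M * real n) = real (Suc x) / real M"
      using n M by (simp add: field_simps)
    also have "1 + 6 * sqrt (real (Suc x) / real M) * real (card ?T) = 1 + sqrt (real (Suc x)) * c"
      by (simp add: c_def real_sqrt_divide)
    also have "\<dots> \<le> 1 + real (Suc x) * c"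
    proof -
      have "sqrt (real (Suc x)) \<le> real (Suc x)"
        by (rule real_le_lsqrt) (auto simp: power2_eq_square)
      then show ?thesis using c0 by (intro add_left_mono mult_right_mono)
    qed
    also have "\<dots> \<le> (real x + 1) * (1 + c)" using c0 by (simp add: algebra_simps)
    finally show "real (card (?U x)) \<le> (real x + 1) * (1 + c)" .
  qed auto
  also have "\<dots> = (\<Sum>x<M. (real x + 1) * ?e x) * (1 + c)"
    by (subst sum_distrib_right) (intro sum.cong refl, simp)
  also have "(\<Sum>x<M. (real x + 1) * ?e x) \<le> layer_const"
    unfolding layer_const_def using summable_layer by (intro sum_le_suminf) auto
  finally show ?thesis
    by (simp add: c_def mult_right_mono)
qed

section \<open>Counting structured vectors\<close>

text \<open>
  \<open>rep p [B1, \<dots>, Bk] a v\<close> is the probability that \<open>a(i1) - a(j1) + \<dots> + a(ik) - a(jk)\<close> is \<open>v\<close> modulo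
  \<open>p\<close> for independent uniform \<open>il, jl \<in> Bl\<close>. For \<open>i\<close> in a block, \<open>wt\<close> collects the solutions for
  \<open>v = 0\<close> in which the earlier blocks contribute trivially and \<open>i\<close> occurs exactly once, so that the
  value at \<open>i\<close> is determined by the other coordinates.
\<close>
primrec rep :: "nat \<Rightarrow> nat set list \<Rightarrow> (nat \<Rightarrow> int) \<Rightarrow> int \<Rightarrow> real" where
  "rep p [] a v = (if int p dvd v then 1 else 0)"
| "rep p (B # Bs) a v = (\<Sum>(i, j)\<in>B \<times> B. rep p Bs a (v - (a i - a j))) / (real (card B))\<^sup>2"

primrec wt :: "nat \<Rightarrow> nat set list \<Rightarrow> (nat \<Rightarrow> int) \<Rightarrow> nat \<Rightarrow> real" where
  "wt p [] a i = 0"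
| "wt p (B # Bs) a i = (if i \<in> B then (\<Sum>j\<in>B - {i}. rep p Bs a (a j - a i)) / (real (card B))\<^sup>2
     else wt p Bs a i)"

primrec blocks :: "nat \<Rightarrow> nat set list \<Rightarrow> bool" where
  "blocks q [] \<longleftrightarrow> True"
| "blocks q (B # Bs) \<longleftrightarrow> finite B \<and> card B = q \<and> B \<inter> \<Union>(set Bs) = {} \<and> blocks q Bs"

lemma rep_nonneg: "rep p Bs a v \<ge> 0"
  by (induction Bs arbitrary: v) (auto intro!: divide_nonneg_nonneg sum_nonneg)

lemma wt_nonneg: "wt p Bs a i \<ge> 0"
  by (induction Bs) (auto intro!: divide_nonneg_nonneg sum_nonneg rep_nonneg)

lemma rep_cong:
  "(\<And>i. i \<in> \<Union>(set Bs) \<Longrightarrow> a i = a' i) \<Longrightarrow> rep p Bs a v = rep p Bs a' v"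
proof (induction Bs arbitrary: v)
  case (Cons B Bs)
  then have "rep p Bs a v = rep p Bs a' v" for v by simp
  moreover have "\<And>i. i \<in> B \<Longrightarrow> a i = a' i" using Cons.prems by simp
  ultimately show ?case by (auto intro!: arg_cong[where f = "\<lambda>x. x / _"] sum.cong)
qed simp

lemma wt_cong:
  "(\<And>i. i \<in> \<Union>(set Bs) \<Longrightarrow> a i = a' i) \<Longrightarrow> wt p Bs a i = wt p Bs a' i"
proof (induction Bs)
  case (Cons B Bs)
  have "rep p Bs a v = rep p Bs a' v" for v by (rule rep_cong) (use Cons.prems in auto)
  moreover have "\<And>i. i \<in> B \<Longrightarrow> a i = a' i" using Cons.prems by simp
  moreover have "wt p Bs a i = wt p Bs a' i" using Cons by simp
  ultimately show ?case by (auto intro!: arg_cong[where f = "\<lambda>x. x / _"] sum.cong)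
qed simp

lemma finite_blocks: "blocks q Bs \<Longrightarrow> finite (\<Union>(set Bs))"
  by (induction Bs) auto

text \<open>Over the residues, \<open>rep p Bs a\<close> is a probability distribution, or zero if
  some block is empty; reflection and translation of its argument do not change the total.\<close>

lemma sum_rep_le:
  assumes p: "p > 0"
  shows "(\<Sum>v\<in>{0..<int p}. rep p Bs a (c - v)) \<le> 1"
proof (induction Bs arbitrary: c)
  case Nil
  have "v = c mod int p" if "v \<in> {0..<int p}" "int p dvd c - v" for v
    using that by (metis atLeastLessThan_iff mod_eq_dvd_iff mod_pos_pos_trivial)
  then have "{v \<in> {0..<int p}. int p dvd c - v} \<subseteq> {c mod int p}" by blast
  then have "card {v \<in> {0..<int p}. int p dvd c - v} \<le> card {c mod int p}"
    by (intro card_mono) auto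
  moreover have "(\<Sum>v\<in>{0..<int p}. rep p [] a (c - v)) = (\<Sum>v\<in>{v \<in> {0..<int p}. int p dvd c - v}. 1)"
    by (intro sum.mono_neutral_cong_right) auto
  ultimately show ?case by simp
next
  case (Cons B Bs)
  have "(\<Sum>v\<in>{0..<int p}. rep p (B # Bs) a (c - v)) =
     (\<Sum>(i, j)\<in>B \<times> B. \<Sum>v\<in>{0..<int p}. rep p Bs a ((c - (a i - a j)) - v)) / (real (card B))\<^sup>2"
    by (simp add: case_prod_unfold flip: sum_divide_distrib)
      (subst sum.swap, simp add: algebra_simps)
  also have "\<dots> \<le> (\<Sum>(i, j)\<in>B \<times> B. 1) / (real (card B))\<^sup>2"
    by (intro divide_right_mono sum_mono) (auto intro: Cons)
  also have "\<dots> \<le> 1" by (simp add: card_cartesian_product power2_eq_square divide_le_eq_1)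
  finally show ?case .
qed

text \<open>Only the block \<open>B\<close> that contains \<open>i\<close> feels a change of
  \<open>a i\<close>, since the later blocks are disjoint from it. For each of the
  \<open>q - 1\<close> partners \<open>j\<close> the later blocks must hit \<open>a j - v\<close>,
  which has total probability at most 1 over all \<open>v\<close>; the denominator is
  \<open>q^2\<close>. In this sense the other coordinates nearly determine
  \<open>a i\<close>.\<close>

lemma sum_wt_le:
  assumes p: "p > 0" and q: "q > 0" and Bs: "blocks q Bs"
  shows "(\<Sum>v\<in>{0..<int p}. wt p Bs (a(i := v)) i) \<le> 1 / real q"
  using Bs
proof (induction Bs)
  case (Cons B Bs)
  show ?case
  proof (cases "i \<in> B")
    case True
    have rep: "rep p Bs (a(i := v)) x = rep p Bs a x" for v x
      using True Cons.prems by (intro rep_cong) auto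
    have "(\<Sum>v\<in>{0..<int p}. wt p (B # Bs) (a(i := v)) i) =
        (\<Sum>j\<in>B - {i}. \<Sum>v\<in>{0..<int p}. rep p Bs a (a j - v)) / (real q)\<^sup>2"
      using True Cons.prems
      by (simp add: rep flip: sum_divide_distrib) (subst sum.swap, simp)
    also have "\<dots> \<le> (\<Sum>j\<in>B - {i}. 1) / (real q)\<^sup>2"
      by (intro divide_right_mono sum_mono sum_rep_le p) auto
    also have "\<dots> \<le> real q / (real q)\<^sup>2"
      using True Cons.prems by (intro divide_right_mono) (auto simp: card_Diff_singleton)
    also have "\<dots> = 1 / real q" by (simp add: power2_eq_square)
    finally show ?thesis .
  qed (use Cons in auto)
qed auto

text \<open>In the first block the pairs with \<open>i \<noteq> j\<close> give the weights of that
  block, and those with \<open>i = j\<close>, of probability \<open>1 / q\<close>, pass the question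
  on to the later blocks. Solutions that are trivial in every block have probability
  \<open>q^(-k)\<close>.\<close>

lemma rep_le_sum_wt:
  assumes q: "q > 0" and Bs: "blocks q Bs"
  shows "rep p Bs a 0 \<le> (\<Sum>i\<in>\<Union>(set Bs). wt p Bs a i) + (1 / real q) ^ length Bs"
  using Bs
proof (induction Bs)
  case (Cons B Bs)
  let ?U = "\<Union>(set Bs)"
  have B: "finite B" "card B = q" "B \<inter> ?U = {}" "blocks q Bs" using Cons.prems by auto
  have fin: "finite ?U" using B finite_blocks by blast
  have S0: "(\<Sum>i\<in>?U. wt p Bs a i) \<ge> 0" by (intro sum_nonneg wt_nonneg)
  have "(\<Sum>j\<in>B. rep p Bs a (a j - a i)) = rep p Bs a 0 + (\<Sum>j\<in>B - {i}. rep p Bs a (a j - a i))"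
    if "i \<in> B" for i
    using that B by (simp add: sum.remove[of B i])
  then have "(\<Sum>i\<in>B. \<Sum>j\<in>B. rep p Bs a (a j - a i)) =
      (\<Sum>i\<in>B. rep p Bs a 0 + (\<Sum>j\<in>B - {i}. rep p Bs a (a j - a i)))"
    by (intro sum.cong) auto
  also have "\<dots> = real q * rep p Bs a 0 + (\<Sum>i\<in>B. \<Sum>j\<in>B - {i}. rep p Bs a (a j - a i))"
    using B by (simp add: sum.distrib)
  finally have "rep p (B # Bs) a 0 = rep p Bs a 0 / real q +
      (\<Sum>i\<in>B. wt p (B # Bs) a i)"
    using q B by (simp add: sum.cartesian_product[symmetric] add_divide_distrib sum_divide_distrib
        power2_eq_square)
  also have "rep p Bs a 0 / real q \<le>
      ((\<Sum>i\<in>?U. wt p Bs a i) + (1 / real q) ^ length Bs) / real q"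
    using Cons.IH[OF B(4)] by (intro divide_right_mono) auto
  also have "\<dots> \<le> (\<Sum>i\<in>?U. wt p Bs a i) + (1 / real q) ^ length (B # Bs)"
  proof -
    have "(\<Sum>i\<in>?U. wt p Bs a i) / real q \<le> (\<Sum>i\<in>?U. wt p Bs a i) / 1"
      using q S0 by (intro divide_left_mono) auto
    then show ?thesis by (simp add: add_divide_distrib mult.commute)
  qed
  also have "(\<Sum>i\<in>?U. wt p Bs a i) = (\<Sum>i\<in>?U. wt p (B # Bs) a i)"
    using B by (intro sum.cong) auto
  finally show ?case
    using B fin by (simp add: sum.union_disjoint del: wt.simps)
qed simp

text \<open>Each factor is the Fourier transform of \<open>a i - a j\<close> for independent uniform
  \<open>i\<close> and \<open>j\<close> in the block. Taking differences makes it nonnegative, so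
  that \<open>card_low_spread_le_rep\<close> may discard terms.\<close>

lemma rep_fourier:
  assumes p: "p > 0" and fin: "\<forall>B\<in>set Bs. finite B"
  shows "complex_of_real (rep p Bs a v) * of_nat p = (\<Sum>t\<in>{0..<int p}. ep p (t * v) *
     of_real (\<Prod>B\<leftarrow>Bs. (cmod (expsum p B a t))\<^sup>2 / (real (card B))\<^sup>2))"
  using fin
proof (induction Bs arbitrary: v)
  case Nil
  then show ?case using sum_ep[OF p, of v] by simp
next
  case (Cons B Bs)
  let ?P = "\<lambda>t. complex_of_real (\<Prod>B\<leftarrow>Bs. (cmod (expsum p B a t))\<^sup>2 / (real (card B))\<^sup>2)"
  have sq: "complex_of_real ((cmod (expsum p B a t))\<^sup>2) = (\<Sum>(i, j)\<in>B \<times> B. ep p (t * (a j - a i)))" for t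
  proof -
    have "complex_of_real ((cmod (expsum p B a t))\<^sup>2) = cnj (expsum p B a t) * expsum p B a t"
      by (metis complex_norm_square mult.commute)
    also have "\<dots> = (\<Sum>(i, j)\<in>B \<times> B. cnj (ep p (t * a i)) * ep p (t * a j))"
      by (simp add: expsum_def sum_product sum.cartesian_product)
    finally show ?thesis by (simp add: right_diff_distrib ep_diff mult.commute)
  qed
  have "complex_of_real (rep p (B # Bs) a v) * of_nat p =
      (\<Sum>(i, j)\<in>B \<times> B. complex_of_real (rep p Bs a (v - (a i - a j))) * of_nat p) / (of_nat (card B))\<^sup>2"
    by (simp add: case_prod_unfold sum_distrib_right)
  also have "\<dots> = (\<Sum>(i, j)\<in>B \<times> B. \<Sum>t\<in>{0..<int p}. ep p (t * (v - (a i - a j))) * ?P t) / (of_nat (card B))\<^sup>2"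
    using Cons by simp
  also have "\<dots> = (\<Sum>t\<in>{0..<int p}. \<Sum>(i, j)\<in>B \<times> B. ep p (t * (v - (a i - a j))) * ?P t) / (of_nat (card B))\<^sup>2"
    unfolding case_prod_unfold by (subst sum.swap) simp
  also have "\<dots> = (\<Sum>t\<in>{0..<int p}. ep p (t * v) * ((\<Sum>(i, j)\<in>B \<times> B. ep p (t * (a j - a i))) / (of_nat (card B))\<^sup>2 * ?P t))"
    unfolding sum_divide_distrib sum_distrib_left sum_distrib_right case_prod_unfold
    by (intro sum.cong refl) (simp add: right_diff_distrib ep_diff ep_add cnj_ep algebra_simps)
  also have "\<dots> = (\<Sum>t\<in>{0..<int p}. ep p (t * v) *
     of_real (\<Prod>B\<leftarrow>B # Bs. (cmod (expsum p B a t))\<^sup>2 / (real (card B))\<^sup>2))"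
    unfolding sq[symmetric] by simp
  finally show ?case .
qed

text \<open>If the spread over \<open>b\<close> is at most \<open>q^2\<close>, so is the spread over
  each block \<open>B\<close>, and \<open>spread = 2 * (q^2 - |expsum|^2)\<close> forces
  \<open>|expsum|^2 / q^2 \<ge> 1 / 2\<close>. Every such residue thus contributes at least
  \<open>2^(-k)\<close> to the nonnegative Fourier sum of \<open>rep\<close>.\<close>

lemma card_low_spread_le_rep:
  assumes p: "p > 0" and q: "q > 0" and b: "finite b" "\<Union>(set Bs) \<subseteq> b" and Bs: "blocks q Bs"
    and X: "X \<le> (real q)\<^sup>2"
  shows "real (card (low_spread p b a X)) \<le> 2 ^ length Bs * (real p * rep p Bs a 0)"
proof -
  let ?F = "\<lambda>t. \<Prod>B\<leftarrow>Bs. (cmod (expsum p B a t))\<^sup>2 / (real (card B))\<^sup>2"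
  have Bs': "finite B \<and> card B = q" if "B \<in> set Bs" for B
    using Bs that by (induction Bs) auto
  have nonneg: "?F t \<ge> 0" for t by (induction Bs) auto
  have ge: "(1 / 2) ^ length Bs \<le> ?F t" if t: "t \<in> low_spread p b a X" for t
  proof -
    have "1 / 2 \<le> (cmod (expsum p B a t))\<^sup>2 / (real (card B))\<^sup>2" if B: "B \<in> set Bs" for B
    proof -
      have "spread p B a t \<le> spread p b a t" using b B by (intro spread_mono) auto
      also have "\<dots> \<le> (real q)\<^sup>2" using t X by (auto simp: low_spread_def)
      finally show ?thesis using q Bs'[OF B] by (simp add: spread_eq field_simps)
    qed
    then show ?thesis
    proof (induction Bs)
      case (Cons B Bs)
      have "1 / 2 * (1 / 2) ^ length Bs \<le> (cmod (expsum p B a t))\<^sup>2 / (real (card B))\<^sup>2 *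
          (\<Prod>B\<leftarrow>Bs. (cmod (expsum p B a t))\<^sup>2 / (real (card B))\<^sup>2)"
        using Cons by (intro mult_mono) auto
      then show ?case by simp
    qed simp
  qed
  have "complex_of_real (rep p Bs a 0) * of_nat p = (\<Sum>t\<in>{0..<int p}. of_real (?F t))"
    using rep_fourier[OF p, of Bs a 0] Bs' by simp
  then have "complex_of_real (real p * rep p Bs a 0) = complex_of_real (\<Sum>t\<in>{0..<int p}. ?F t)"
    by (simp add: mult.commute)
  then have "real p * rep p Bs a 0 = (\<Sum>t\<in>{0..<int p}. ?F t)" by (simp only: of_real_eq_iff)
  also have "\<dots> \<ge> (\<Sum>t\<in>low_spread p b a X. ?F t)"
    using nonneg by (intro sum_mono2) (auto simp: low_spread_def)
  also have "(\<Sum>t\<in>low_spread p b a X. ?F t) \<ge> (\<Sum>t\<in>low_spread p b a X. (1 / 2) ^ length Bs)"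
    by (intro sum_mono ge)
  finally show ?thesis by (simp add: power_one_over field_simps)
qed

section \<open>Peeling off coordinates\<close>

lemma ex_blocks:
  assumes "finite b" "k * q \<le> card b"
  shows "\<exists>Bs. length Bs = k \<and> blocks q Bs \<and> \<Union>(set Bs) \<subseteq> b"
  using assms
proof (induction k arbitrary: b)
  case 0 then show ?case by auto
next
  case (Suc k)
  then obtain B where B: "B \<subseteq> b" "card B = q" "finite B"
    by (metis obtain_subset_with_card_n le_add1 le_trans mult_Suc)
  have "k * q \<le> card (b - B)" using Suc.prems B by (simp add: card_Diff_subset)
  then obtain Bs where Bs: "length Bs = k" "blocks q Bs" "\<Union>(set Bs) \<subseteq> b - B"
    using Suc.IH[of "b - B"] Suc.prems by auto
  then show ?case using B by (intro exI[of _ "B # Bs"]) auto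
qed

text \<open>The choice depends on the set alone and not on the vector. The weights attached to
  \<open>b\<close> are therefore one fixed function of the coordinates in \<open>b\<close>, as
  summation over all vectors in \<open>sum_peel_le\<close> requires.\<close>

definition blk :: "nat \<Rightarrow> nat set \<Rightarrow> nat set list" where
  "blk k b = (SOME Bs. length Bs = k \<and> blocks (card b div k) Bs \<and> \<Union>(set Bs) \<subseteq> b)"

lemma blk:
  assumes "finite b"
  shows "length (blk k b) = k" "blocks (card b div k) (blk k b)" "\<Union>(set (blk k b)) \<subseteq> b"
proof -
  have "\<exists>Bs. length Bs = k \<and> blocks (card b div k) Bs \<and> \<Union>(set Bs) \<subseteq> b"
    using assms by (intro ex_blocks) auto
  from someI_ex[OF this] show "length (blk k b) = k" "blocks (card b div k) (blk k b)" "\<Union>(set (blk k b)) \<subseteq> b"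
    unfolding blk_def by auto
qed

text \<open>Unfolded, this is a sum over all sequences of \<open>s\<close> distinct elements of
  \<open>b\<close>, of the product of the weights taken in the successively shrinking sets.\<close>

primrec peel :: "(nat set \<Rightarrow> (nat \<Rightarrow> int) \<Rightarrow> nat \<Rightarrow> real) \<Rightarrow> nat \<Rightarrow> nat set \<Rightarrow> (nat \<Rightarrow> int) \<Rightarrow> real" where
  "peel W 0 b a = 1"
| "peel W (Suc s) b a = (\<Sum>i\<in>b. W b a i * peel W s (b - {i}) a)"

lemma peel_cong:
  assumes W: "\<And>b a a' i. (\<And>j. j \<in> b \<Longrightarrow> a j = a' j) \<Longrightarrow> finite b \<Longrightarrow> W b a i = W b a' i"
    and "finite b" and a: "\<And>j. j \<in> b \<Longrightarrow> a j = a' j"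
  shows "peel W s b a = peel W s b a'"
  using assms(2,3)
proof (induction s arbitrary: b)
  case (Suc s)
  have "peel W s (b - {i}) a = peel W s (b - {i}) a'" for i
    using Suc.prems by (intro Suc.IH) auto
  then show ?case using W[of b a a'] Suc.prems by simp
qed simp

lemma peel_ge:
  assumes W: "\<And>b a i. W b a i \<ge> 0" and \<beta>: "\<beta> \<ge> 0"
    and sum: "\<And>b'. b' \<subseteq> b \<Longrightarrow> card b' > m \<Longrightarrow> (\<Sum>i\<in>b'. W b' a i) \<ge> \<beta>"
    and "finite b" "card b = m + s"
  shows "peel W s b a \<ge> \<beta> ^ s"
  using assms(3-)
proof (induction s arbitrary: b)
  case (Suc s)
  have "\<beta> * \<beta> ^ s \<le> (\<Sum>i\<in>b. W b a i) * \<beta> ^ s"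
    using Suc.prems \<beta> by (intro mult_right_mono Suc.prems(1)) auto
  also have "\<dots> = (\<Sum>i\<in>b. W b a i * \<beta> ^ s)" by (simp add: sum_distrib_right)
  also have "\<dots> \<le> (\<Sum>i\<in>b. W b a i * peel W s (b - {i}) a)"
    using Suc.prems by (intro sum_mono mult_left_mono W Suc.IH) auto
  finally show ?case by simp
qed simp

text \<open>
  The sum over all orders in which coordinates can be peeled off is what avoids a factorial loss:
  a fixed order would have to be paid for by a union bound.
\<close>
lemma sum_peel_le:
  assumes W: "\<And>b a i. W b a i \<ge> 0"
    and cong: "\<And>b a a' i. (\<And>j. j \<in> b \<Longrightarrow> a j = a' j) \<Longrightarrow> finite b \<Longrightarrow> W b a i = W b a' i"
    and sum: "\<And>b a i. finite b \<Longrightarrow> card b > m \<Longrightarrow> (\<Sum>v\<in>V. W b (a(i := v)) i) \<le> \<kappa> / real (card b)"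
    and V: "finite V" and \<kappa>: "\<kappa> \<ge> 0" and b: "finite b" "card b = m + s"
  shows "(\<Sum>a\<in>b \<rightarrow>\<^sub>E V. peel W s b a) \<le> \<kappa> ^ s * real (card V) ^ m"
  using b
proof (induction s arbitrary: b)
  case 0
  then show ?case using V by (simp add: card_PiE)
next
  case (Suc s)
  have nn: "peel W s b a \<ge> 0" for s b a
    by (induction s arbitrary: b) (auto intro!: sum_nonneg mult_nonneg_nonneg W)
  have one: "(\<Sum>a\<in>b \<rightarrow>\<^sub>E V. W b a i * peel W s (b - {i}) a) \<le>
      \<kappa> / real (card b) * (\<kappa> ^ s * real (card V) ^ m)" if i: "i \<in> b" for i
  proof -
    let ?c = "b - {i}"
    have b: "b = insert i ?c" using i by auto
    have "(\<Sum>a\<in>b \<rightarrow>\<^sub>E V. W b a i * peel W s ?c a) =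
        (\<Sum>a\<in>(\<lambda>(y, g). g(i := y)) ` (V \<times> (?c \<rightarrow>\<^sub>E V)). W b a i * peel W s ?c a)"
      by (subst b) (simp add: PiE_insert_eq del: insert_Diff_single)
    also have "\<dots> = (\<Sum>(y, g)\<in>V \<times> (?c \<rightarrow>\<^sub>E V). W b (g(i := y)) i * peel W s ?c (g(i := y)))"
    proof (subst sum.reindex)
      show "inj_on (\<lambda>(y, g). g(i := y)) (V \<times> (?c \<rightarrow>\<^sub>E V))" by (rule inj_combinator) simp
    qed (simp add: case_prod_unfold)
    \<comment> \<open>The remaining factor reads only the coordinates in \<open>b - {i}\<close>, so
      the sum over the value at \<open>i\<close> meets a single weight.\<close>
    also have "\<dots> = (\<Sum>(y, g)\<in>V \<times> (?c \<rightarrow>\<^sub>E V). W b (g(i := y)) i * peel W s ?c g)"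
    proof (intro sum.cong refl, clarify)
      fix y g
      have "peel W s ?c (g(i := y)) = peel W s ?c g"
        using Suc.prems by (intro peel_cong cong) auto
      then show "W b (g(i := y)) i * peel W s ?c (g(i := y)) = W b (g(i := y)) i * peel W s ?c g"
        by simp
    qed
    also have "\<dots> = (\<Sum>g\<in>?c \<rightarrow>\<^sub>E V. (\<Sum>y\<in>V. W b (g(i := y)) i) * peel W s ?c g)"
      by (subst sum.cartesian_product[symmetric], subst sum.swap) (simp add: sum_distrib_right)
    also have "\<dots> \<le> (\<Sum>g\<in>?c \<rightarrow>\<^sub>E V. \<kappa> / real (card b) * peel W s ?c g)"
      using Suc.prems by (intro sum_mono mult_right_mono sum nn) auto
    also have "\<dots> \<le> \<kappa> / real (card b) * (\<kappa> ^ s * real (card V) ^ m)"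
      unfolding sum_distrib_left[symmetric] using Suc.prems i \<kappa>
      by (intro mult_left_mono Suc.IH) auto
    finally show ?thesis .
  qed
  have "(\<Sum>a\<in>b \<rightarrow>\<^sub>E V. peel W (Suc s) b a) = (\<Sum>i\<in>b. \<Sum>a\<in>b \<rightarrow>\<^sub>E V. W b a i * peel W s (b - {i}) a)"
    by simp (rule sum.swap)
  also have "\<dots> \<le> (\<Sum>i\<in>b. \<kappa> / real (card b) * (\<kappa> ^ s * real (card V) ^ m))"
    by (intro sum_mono one)
  \<comment> \<open>The \<open>card b\<close> choices of \<open>i\<close> cancel the denominator in
    the bound for one weight; each peeled coordinate costs just \<kappa>.\<close>
  also have "\<dots> = \<kappa> ^ Suc s * real (card V) ^ m" using Suc.prems by auto
  finally show ?case .
qed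

text \<open>The hypothesis says that the weights of every set with more than \<open>m\<close>
  elements add up to at least \<open>r a / L\<close>, so \<open>peel\<close> is at least the power
  \<open>n - m\<close> of this number. Summed over all vectors, \<open>peel\<close> costs
  \<open>2 * k\<close> per removed coordinate, and the last \<open>m\<close> coordinates are
  free.\<close>

lemma sum_power_le_peel:
  assumes p: "p > 0" and k: "k > 0" and m: "k \<le> m" "m \<le> n" and L: "L > 0"
    and Z: "Z \<subseteq> {..<n} \<rightarrow>\<^sub>E {0..<int p}"
    and r: "\<And>a. a \<in> Z \<Longrightarrow> r a \<ge> 0"
      "\<And>a b. a \<in> Z \<Longrightarrow> b \<subseteq> {..<n} \<Longrightarrow> card b > m \<Longrightarrow> r a \<le> L * (\<Sum>i\<in>b. wt p (blk k b) a i)"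
  shows "(\<Sum>a\<in>Z. r a ^ (n - m)) \<le> (2 * real k * L) ^ (n - m) * real p ^ m"
proof -
  define W where "W b a i = wt p (blk k b) a i" for b a i
  let ?s = "n - m"
  have W: "W b a i \<ge> 0" for b a i by (simp add: W_def wt_nonneg)
  have cong: "W b a i = W b a' i" if "\<And>j. j \<in> b \<Longrightarrow> a j = a' j" "finite b" for b a a' i
    unfolding W_def using that blk(3)[OF that(2), of k] by (intro wt_cong) auto
  have "(\<Sum>a\<in>Z. (r a / L) ^ ?s) \<le> (\<Sum>a\<in>Z. peel W ?s {..<n} a)"
  proof (intro sum_mono peel_ge[OF W])
    fix a b' assume "a \<in> Z" "b' \<subseteq> {..<n}" "card b' > m"
    then show "(\<Sum>i\<in>b'. W b' a i) \<ge> r a / L"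
      using r(2)[of a b'] L by (simp add: W_def field_simps)
  qed (use r L m in auto)
  also have "\<dots> \<le> (\<Sum>a\<in>{..<n} \<rightarrow>\<^sub>E {0..<int p}. peel W ?s {..<n} a)"
  proof (intro sum_mono2 Z)
    have "peel W s b a \<ge> 0" for s b a
      by (induction s arbitrary: b) (auto intro!: sum_nonneg mult_nonneg_nonneg W)
    then show "peel W ?s {..<n} a \<ge> 0" for a .
  qed (auto intro: finite_PiE)
  also have "\<dots> \<le> (2 * real k) ^ ?s * real (card {0..<int p}) ^ m"
  proof (rule sum_peel_le[OF W cong])
    fix b :: "nat set" and a :: "nat \<Rightarrow> int" and i assume b: "finite b" "card b > m"
    have q: "card b div k > 0" using b m k by (simp add: div_greater_zero_iff)
    have "(\<Sum>v\<in>{0..<int p}. W b (a(i := v)) i) \<le> 1 / real (card b div k)"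
      unfolding W_def by (intro sum_wt_le p q blk b)
    \<comment> \<open>Rounding \<open>card b / k\<close> down loses at most a factor 2, because
      \<open>card b > m \<ge> k\<close>.\<close>
    also have "\<dots> \<le> 2 * real k / real (card b)"
    proof -
      have "card b < k * (card b div k) + k"
        using k by (metis add.commute dividend_less_times_div)
      also have "\<dots> \<le> k * (card b div k) + k * (card b div k)" using q by simp
      finally have "real (card b) \<le> real (2 * k * (card b div k))"
        by (intro of_nat_mono) linarith
      then show ?thesis using q b by (simp add: field_simps)
    qed
    finally show "(\<Sum>v\<in>{0..<int p}. W b (a(i := v)) i) \<le> 2 * real k / real (card b)" .
  qed (use m in auto)
  finally have "(\<Sum>a\<in>Z. (r a / L) ^ ?s) \<le> (2 * real k) ^ ?s * real p ^ m" by simp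
  moreover have "(\<Sum>a\<in>Z. (r a / L) ^ ?s) = (\<Sum>a\<in>Z. r a ^ ?s) / L ^ ?s"
    by (simp add: power_divide sum_divide_distrib)
  ultimately have "(\<Sum>a\<in>Z. r a ^ ?s) / L ^ ?s \<le> (2 * real k) ^ ?s * real p ^ m" by simp
  then have "(\<Sum>a\<in>Z. r a ^ ?s) \<le> ((2 * real k) ^ ?s * real p ^ m) * L ^ ?s"
    using L by (simp only: pos_divide_le_eq zero_less_power)
  then show ?thesis by (simp add: power_mult_distrib mult_ac)
qed

section \<open>The sum over exceptional vectors\<close>

lemma rho_nonneg: "rho p n a \<ge> 0"
  by (simp add: rho_def)

lemma rho_le_1: "rho p n a \<le> 1"
proof -
  have "card {S \<in> slice n. int p dvd sum a S} \<le> card (slice n)" by (intro card_mono) auto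
  then show ?thesis by (simp add: rho_def card_slice divide_le_eq_1)
qed

text \<open>The row involves all coordinates while the level set refers only to \<open>b\<close>:
  shrinking the coordinate set lowers the spread and so weakens the exponential decay. This makes
  the bound usable at every stage of the peeling.\<close>

lemma rho_le_low_spread:
  assumes p: "prime p" and n: "n > 0" "even n" and M: "M > 0" and b: "b \<subseteq> {..<n}"
    and big: "spread p b a z > 2 * real M * real n"
  shows "rho p n a \<le> 2 * layer_const / real p
    + 12 * layer_const / sqrt (real M) * (real (card (low_spread p b a (2 * real M * real n))) / real p)
    + 2 * exp (- real M / 16)"
proof -
  have p0: "p > 0" using p prime_gt_0_nat by blast
  have "rho p n a \<le> 2 / real p * (\<Sum>t\<in>{0..<int p}. exp (- spread p {..<n} a t / (32 * real n)))"
    by (rule rho_le_sum_exp[OF p0 n])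
  also have "\<dots> \<le> 2 / real p * (\<Sum>t\<in>{0..<int p}. exp (- spread p b a t / (32 * real n)))"
    using b n by (intro mult_left_mono sum_mono) (auto intro!: divide_right_mono spread_mono)
  also have "\<dots> \<le> 2 / real p * (layer_const * (1 + 6 * real (card (low_spread p b a (2 * real M * real n))) / sqrt (real M))
    + real p * exp (- real M / 16))"
    by (intro mult_left_mono sum_exp_spread_le[OF p n(1) M big]) auto
  also have "\<dots> = 2 * layer_const / real p
    + 12 * layer_const / sqrt (real M) * (real (card (low_spread p b a (2 * real M * real n))) / real p)
    + 2 * exp (- real M / 16)"
    using p0 M by (simp add: field_simps)
  finally show ?thesis .
qed

lemma rho_le_sum_wt:
  fixes \<tau> :: real
  assumes p: "prime p" and n: "n > 0" "even n" and M: "M > 0" and k: "k > 0" and q: "q > 0"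
    and Mq: "2 * real M * real n \<le> (real q)\<^sup>2"
    and small: "2 * layer_const / real p + 12 * layer_const / sqrt (real M) * (2 / real q) ^ k
      + 2 * exp (- real M / 16) \<le> \<tau> / 2"
    and small': "(2 / real q) ^ k \<le> 1 / 2"
    and rho: "rho p n a \<ge> \<tau>" and big: "spread p {..<n} a z > 2 * real M * real n"
    and b: "b \<subseteq> {..<n}" "card b > k * q"
  shows "rho p n a \<le> 48 * layer_const * 2 ^ k / sqrt (real M) * (\<Sum>i\<in>b. wt p (blk k b) a i)"
proof -
  have p0: "p > 0" using p prime_gt_0_nat by blast
  have fin: "finite b" using b finite_subset by blast
  define X where "X = 2 * real M * real n"
  define c where "c = layer_const / sqrt (real M)"
  define S where "S = (\<Sum>i\<in>b. wt p (blk k b) a i)"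
  have c: "c > 0" using layer_const_pos M by (simp add: c_def)
  have qb: "q \<le> card b div k"
    using b k by (metis div_le_mono less_imp_le nonzero_mult_div_cancel_left not_gr_zero)
  note blk = blk[OF fin, of k]
  have rep: "rep p (blk k b) a 0 \<le> S + (1 / real q) ^ k"
  proof -
    have "rep p (blk k b) a 0 \<le> (\<Sum>i\<in>\<Union>(set (blk k b)). wt p (blk k b) a i) + (1 / real (card b div k)) ^ k"
      using rep_le_sum_wt[OF _ blk(2), of p a] qb q blk(1) by simp
    also have "\<dots> \<le> S + (1 / real q) ^ k"
      unfolding S_def using qb q fin blk(3)
      by (intro add_mono sum_mono2 power_mono divide_left_mono) (auto simp: wt_nonneg)
    finally show ?thesis .
  qed
  have low: "real (card (low_spread p b a X)) / real p \<le> 2 ^ k * S + (2 / real q) ^ k"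
  proof -
    have "(real q)\<^sup>2 \<le> (real (card b div k))\<^sup>2" using qb by (intro power_mono) auto
    then have "X \<le> (real (card b div k))\<^sup>2" using Mq X_def by linarith
    then have "real (card (low_spread p b a X)) \<le> 2 ^ length (blk k b) * (real p * rep p (blk k b) a 0)"
      using qb q fin blk p0 by (intro card_low_spread_le_rep) auto
    then have "real (card (low_spread p b a X)) / real p \<le> 2 ^ k * rep p (blk k b) a 0"
      using p0 blk(1) by (simp add: field_simps)
    also have "\<dots> \<le> 2 ^ k * (S + (1 / real q) ^ k)" using rep by (intro mult_left_mono) auto
    finally show ?thesis by (simp add: ring_distribs power_divide)
  qed
  have "rho p n a \<le> 48 * c * 2 ^ k * S"
  proof (cases "\<exists>z. spread p b a z > X")
    case True
    then have "rho p n a \<le> 2 * layer_const / real p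
      + 12 * c * (real (card (low_spread p b a X)) / real p) + 2 * exp (- real M / 16)"
      using rho_le_low_spread[OF p n M b(1)] by (auto simp: X_def c_def)
    also have "\<dots> \<le> 2 * layer_const / real p + 12 * c * (2 ^ k * S + (2 / real q) ^ k) + 2 * exp (- real M / 16)"
      using c low by (intro add_mono mult_left_mono order.refl) auto
    \<comment> \<open>Since \<open>rho p n a \<ge> \<tau>\<close>, the error
      \<open>\<tau> / 2\<close> is absorbed by half of the left-hand side.\<close>
    also have "\<dots> \<le> 12 * c * 2 ^ k * S + \<tau> / 2"
      using small by (simp add: c_def algebra_simps)
    finally have "rho p n a \<le> 24 * c * 2 ^ k * S" using rho by linarith
    moreover have "S \<ge> 0" unfolding S_def by (intro sum_nonneg wt_nonneg)
    then have "24 * c * 2 ^ k * S \<le> 48 * c * 2 ^ k * S" using c by (intro mult_right_mono) auto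
    ultimately show ?thesis by linarith
  next
    case False
    \<comment> \<open>All residues are low on \<open>b\<close>, so
      \<open>2^k * S \<ge> 1 / 2\<close>. The gain \<open>1 / sqrt M\<close> now comes from the full
      coordinate set, where \<open>z\<close> has large spread, with the trivial bound 1 for the
      density of its low residues.\<close>
    then have "low_spread p b a X = {0..<int p}" by (auto simp: low_spread_def not_less)
    then have "1 \<le> 2 ^ k * S + (2 / real q) ^ k" using low p0 by simp
    then have S: "1 / 2 \<le> 2 ^ k * S" using small' by linarith
    have "card (low_spread p {..<n} a X) \<le> card {0..<int p}"
      by (intro card_mono) (auto simp: low_spread_def)
    then have le1: "real (card (low_spread p {..<n} a X)) / real p \<le> 1" using p0 by simp
    have "rho p n a \<le> 2 * layer_const / real p
      + 12 * c * (real (card (low_spread p {..<n} a X)) / real p) + 2 * exp (- real M / 16)"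
      using rho_le_low_spread[OF p n M subset_refl big] by (simp add: X_def c_def)
    also have "\<dots> \<le> 2 * layer_const / real p + 12 * c * 1 + 2 * exp (- real M / 16)"
      using c le1 by (intro add_mono mult_left_mono order.refl) auto
    also have "\<dots> \<le> 12 * c + \<tau> / 2"
    proof -
      have "12 * c * (2 / real q) ^ k \<ge> 0" using c by simp
      then show ?thesis using small by (simp add: c_def)
    qed
    finally have "rho p n a \<le> 24 * c" using rho by linarith
    also have "\<dots> = 48 * c * (1 / 2)" by simp
    also have "\<dots> \<le> 48 * c * (2 ^ k * S)" using S c by (intro mult_left_mono) auto
    finally show ?thesis by (simp add: mult.assoc)
  qed
  then show ?thesis by (simp add: c_def S_def mult_ac)
qed

section \<open>Nearly constant vectors\<close>

lemma sum_spread: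
  assumes p: "p > 0" and b: "finite b" and a: "\<And>i. i \<in> b \<Longrightarrow> a i \<in> {0..<int p}"
  shows "(\<Sum>t\<in>{0..<int p}. spread p b a t) = 2 * real p * real (\<Sum>i\<in>b. card {j \<in> b. a j \<noteq> a i})"
proof -
  have one: "(\<Sum>t\<in>{0..<int p}. (cmod (ep p (t * a i) - ep p (t * a j)))\<^sup>2) = (if a j \<noteq> a i then 2 * real p else 0)"
    if ij: "i \<in> b" "j \<in> b" for i j
  proof -
    have "int p dvd a i - a j \<longleftrightarrow> a j = a i"
    proof
      assume "int p dvd a i - a j"
      then have "a i mod int p = a j mod int p" by (simp add: mod_eq_dvd_iff)
      then show "a j = a i" using a[OF ij(1)] a[OF ij(2)] by simp
    qed simp
    then have "(\<Sum>t\<in>{0..<int p}. ep p (t * (a i - a j))) = (if a j = a i then of_nat p else 0)"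
      using sum_ep[OF p, of "a i - a j"] by simp
    moreover have "(\<Sum>t\<in>{0..<int p}. (cmod (ep p (t * a i) - ep p (t * a j)))\<^sup>2) =
        2 * real p - 2 * Re (\<Sum>t\<in>{0..<int p}. ep p (t * (a i - a j)))"
      by (simp add: cmod_diff_unit right_diff_distrib ep_diff sum_subtractf sum_distrib_left)
    ultimately show ?thesis by simp
  qed
  have "(\<Sum>t\<in>{0..<int p}. spread p b a t) =
      (\<Sum>(i, j)\<in>b \<times> b. \<Sum>t\<in>{0..<int p}. (cmod (ep p (t * a i) - ep p (t * a j)))\<^sup>2)"
    unfolding spread_def case_prod_unfold by (rule sum.swap)
  also have "\<dots> = (\<Sum>i\<in>b. \<Sum>j\<in>b. if a j \<noteq> a i then 2 * real p else 0)"
    unfolding sum.cartesian_product[symmetric] by (intro sum.cong refl one)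
  also have "\<dots> = (\<Sum>i\<in>b. 2 * real p * real (card {j \<in> b. a j \<noteq> a i}))"
    using b by (intro sum.cong refl) (simp add: sum.If_cases Int_def)
  finally show ?thesis by (simp add: sum_distrib_left)
qed

text \<open>Averaging twice: by \<open>sum_spread\<close> the mean of the spread over
  \<open>t\<close> is twice the number of ordered pairs of coordinates with different values. If it
  is at most \<open>2 * M * n\<close>, some \<open>i\<close> differs from at most \<open>M\<close>
  coordinates, and \<open>c = a i\<close> works.\<close>

lemma near_constant:
  assumes p: "p > 0" and n: "n > 0" and a: "a \<in> {..<n} \<rightarrow>\<^sub>E {0..<int p}"
    and small: "\<And>t. spread p {..<n} a t \<le> 2 * real M * real n"
  shows "\<exists>c\<in>{0..<int p}. card {j \<in> {..<n}. a j \<noteq> c} \<le> M"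
proof (rule ccontr)
  assume "\<not> ?thesis"
  moreover have a': "a i \<in> {0..<int p}" if "i \<in> {..<n}" for i by (rule PiE_mem[OF a that])
  ultimately have "Suc M \<le> card {j \<in> {..<n}. a j \<noteq> a i}" if "i \<in> {..<n}" for i
    using that by (meson not_less_eq_eq)
  then have "(\<Sum>i<n. Suc M) \<le> (\<Sum>i<n. card {j \<in> {..<n}. a j \<noteq> a i})" by (intro sum_mono) auto
  then have "real (n * Suc M) \<le> real (\<Sum>i<n. card {j \<in> {..<n}. a j \<noteq> a i})"
    by (simp only: of_nat_le_iff) simp
  then have "2 * real p * real (n * Suc M) \<le> 2 * real p * real (\<Sum>i<n. card {j \<in> {..<n}. a j \<noteq> a i})"
    by (intro mult_left_mono) auto
  also have "\<dots> = (\<Sum>t\<in>{0..<int p}. spread p {..<n} a t)" using sum_spread[OF p finite_lessThan a'] by simp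
  also have "\<dots> \<le> (\<Sum>t\<in>{0..<int p}. 2 * real M * real n)" by (intro sum_mono small)
  also have "\<dots> = 2 * real p * real (n * M)" by simp
  finally show False using p n by simp
qed

lemma card_near_constant_le:
  assumes "M \<le> n"
  shows "card {a \<in> {..<n} \<rightarrow>\<^sub>E {0..<int p}. \<exists>c\<in>{0..<int p}. card {j \<in> {..<n}. a j \<noteq> c} \<le> M}
    \<le> p * (n * p) ^ M" (is "card ?N \<le> _")
proof -
  let ?U = "{U. U \<subseteq> {..<n} \<and> card U = M}"
  let ?F = "\<lambda>c U. \<Pi>\<^sub>E i\<in>{..<n}. if i \<in> U then {0..<int p} else {c}"
  have "?N \<subseteq> (\<Union>c\<in>{0..<int p}. \<Union>U\<in>?U. ?F c U)"
  proof
    fix a assume "a \<in> ?N"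
    then obtain c where a: "a \<in> {..<n} \<rightarrow>\<^sub>E {0..<int p}" "c \<in> {0..<int p}" "card {j \<in> {..<n}. a j \<noteq> c} \<le> M"
      by auto
    obtain U where "{j \<in> {..<n}. a j \<noteq> c} \<subseteq> U" "U \<subseteq> {..<n}" "card U = M"
      using exists_subset_between[of "{j \<in> {..<n}. a j \<noteq> c}" M "{..<n}"] a(3) assms by auto
    moreover then have "a \<in> ?F c U" using a by (auto simp: PiE_iff)
    ultimately show "a \<in> (\<Union>c\<in>{0..<int p}. \<Union>U\<in>?U. ?F c U)" using a by blast
  qed
  moreover have finU: "finite ?U" by (rule finite_subset[of _ "Pow {..<n}"]) auto
  moreover have finF: "finite (?F c U)" for c U by (intro finite_PiE) auto
  ultimately have "card ?N \<le> card (\<Union>c\<in>{0..<int p}. \<Union>U\<in>?U. ?F c U)"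
    by (intro card_mono finite_UN_I) auto
  also have "\<dots> \<le> (\<Sum>c\<in>{0..<int p}. card (\<Union>U\<in>?U. ?F c U))" by (intro card_UN_le) auto
  also have "\<dots> \<le> (\<Sum>c\<in>{0..<int p}. \<Sum>U\<in>?U. card (?F c U))"
    by (intro sum_mono card_UN_le finU)
  also have "\<dots> = (\<Sum>c\<in>{0..<int p}. \<Sum>U\<in>?U. p ^ M)"
  proof (intro sum.cong refl)
    fix c U assume U: "U \<in> ?U"
    then have "{..<n} \<inter> U = U" by auto
    then show "card (?F c U) = p ^ M"
      using U by (simp add: card_PiE if_distrib[of card] prod.If_cases cong: if_cong)
  qed
  also have "\<dots> = p * ((n choose M) * p ^ M)" using n_subsets[of "{..<n}" M] by simp
  also have "\<dots> \<le> p * (n ^ M * p ^ M)" using binomial_le_pow[OF assms] by simp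
  finally show ?thesis by (simp add: power_mult_distrib)
qed

lemma card_slice_split:
  assumes n: "n > 0" "even n" and ij: "i < n" "j < n" "i \<noteq> j"
  shows "card {S \<in> slice n. i \<in> S \<and> j \<notin> S} = (n - 2) choose (n div 2 - 1)"
proof -
  let ?R = "{R. R \<subseteq> {..<n} - {i, j} \<and> card R = n div 2 - 1}"
  have h: "n div 2 > 0" using n by (auto elim: evenE)
  have "bij_betw (insert i) ?R {S \<in> slice n. i \<in> S \<and> j \<notin> S}"
  proof (rule bij_betw_byWitness[where f' = "\<lambda>S. S - {i}"])
    show "insert i ` ?R \<subseteq> {S \<in> slice n. i \<in> S \<and> j \<notin> S}"
    proof (rule image_subsetI)
      fix R assume R: "R \<in> ?R"
      then have "finite R" "i \<notin> R" by (auto intro: finite_subset)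
      then show "insert i R \<in> {S \<in> slice n. i \<in> S \<and> j \<notin> S}" using R ij h by (auto simp: slice_def)
    qed
    show "(\<lambda>S. S - {i}) ` {S \<in> slice n. i \<in> S \<and> j \<notin> S} \<subseteq> ?R"
      by (auto simp: slice_def card_Diff_singleton)
  qed auto
  then have "card {S \<in> slice n. i \<in> S \<and> j \<notin> S} = card ?R" by (simp add: bij_betw_same_card)
  also have "card ?R = card ({..<n} - {i, j}) choose (n div 2 - 1)" by (intro n_subsets) auto
  also have "card ({..<n} - {i, j}) = n - 2" using ij by (subst card_Diff_subset) auto
  finally show ?thesis .
qed

text \<open>Exchanging \<open>i\<close> for \<open>j\<close> changes the sum by
  \<open>a j - a i\<close>, so of the two sets in such a pair at most one is a zero. This excludes
  at least \<open>c\<close> sets, and \<open>c\<close> is at least a quarter of the slice by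
  Pascal's rule applied twice.\<close>

lemma rho_le_three_quarters:
  assumes n: "n > 0" "even n" and ij: "i < n" "j < n" and ne: "\<not> int p dvd a i - a j"
  shows "rho p n a \<le> 3 / 4"
proof -
  have ij': "i \<noteq> j" using ne by auto
  let ?X1 = "{S \<in> slice n. i \<in> S \<and> j \<notin> S}" and ?X2 = "{S \<in> slice n. j \<in> S \<and> i \<notin> S}"
  let ?Z = "{S \<in> slice n. int p dvd sum a S}"
  define c where "c = (n - 2) choose (n div 2 - 1)"
  have X: "card ?X1 = c" "card ?X2 = c"
    using card_slice_split[OF n ij ij'] card_slice_split[OF n ij(2) ij(1)] ij' by (auto simp: c_def)
  define g where "g S = insert j (S - {i})" for S
  have gX: "g S \<in> ?X2 \<and> sum a (g S) = sum a S - a i + a j" if "S \<in> ?X1" for S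
  proof -
    have "finite S" using that by (auto simp: slice_def intro: finite_subset)
    moreover have "i \<in> S" "j \<notin> S" using that by auto
    ultimately have "card (g S) = card S" "sum a (g S) = sum a S - a i + a j"
      using card.remove[of S i] sum.remove[of S i a] by (simp_all add: g_def)
    then show ?thesis using that ij ij' by (auto simp: g_def slice_def)
  qed
  have inj: "inj_on g ?X1" unfolding g_def by (auto intro!: inj_onI)
  have "g ` (?Z \<inter> ?X1) \<inter> (?Z \<inter> ?X2) = {}"
  proof -
    have False if S: "S \<in> ?Z \<inter> ?X1" "g S \<in> ?Z" for S
    proof -
      have "int p dvd sum a S - sum a (g S)" using S by (intro dvd_diff) auto
      then show False using gX[of S] S ne by simp
    qed
    then show ?thesis by blast
  qed
  then have "card (g ` (?Z \<inter> ?X1)) + card (?Z \<inter> ?X2) = card (g ` (?Z \<inter> ?X1) \<union> (?Z \<inter> ?X2))"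
    by (intro card_Un_disjoint[symmetric]) auto
  also have "\<dots> \<le> card ?X2" using gX by (intro card_mono) auto
  also have "card (g ` (?Z \<inter> ?X1)) = card (?Z \<inter> ?X1)"
    using inj by (intro card_image) (auto intro: inj_on_subset)
  finally have 1: "card (?Z \<inter> ?X1) + card (?Z \<inter> ?X2) \<le> c" using X by simp
  have "card ?Z \<le> card ((?Z \<inter> ?X1) \<union> (?Z \<inter> ?X2) \<union> (slice n - ?X1 - ?X2))"
    by (intro card_mono) auto
  also have "\<dots> \<le> card (?Z \<inter> ?X1) + card (?Z \<inter> ?X2) + card (slice n - ?X1 - ?X2)"
    by (meson add_mono card_Un_le le_refl le_trans)
  also have "card (slice n - ?X1 - ?X2) = card (slice n) - c - c"
  proof -
    have "?X2 \<subseteq> slice n - ?X1" by auto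
    then show ?thesis using X by (simp add: card_Diff_subset)
  qed
  finally have Z: "card ?Z \<le> c + (card (slice n) - c - c)" using 1 by linarith
  \<comment> \<open>This rules out truncation in the natural-number difference above.\<close>
  have "card ?X1 + card ?X2 = card (?X1 \<union> ?X2)" by (intro card_Un_disjoint[symmetric]) auto
  also have "\<dots> \<le> card (slice n)" by (intro card_mono) auto
  finally have cc: "c + c \<le> card (slice n)" using X by simp
  have "card (slice n) \<le> 4 * c"
  proof -
    obtain h where h: "n = 2 * Suc h"
      using n by (metis evenE gr0_implies_Suc nat_0_less_mult_iff)
    have "Suc (2 * h) choose h = (2 * h choose h) + (if h = 0 then 0 else 2 * h choose (h - 1))"
      by (cases h) auto
    also have "\<dots> \<le> 2 * (2 * h choose h)"
      using binomial_maximum[of "2 * h" "h - 1"] by auto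
    finally have 1: "Suc (2 * h) choose h \<le> 2 * c" by (simp add: c_def h)
    have "n choose Suc h = (Suc (2 * h) choose h) + (Suc (2 * h) choose Suc h)"
      unfolding h by simp
    also have "Suc (2 * h) choose Suc h = Suc (2 * h) choose h"
      using binomial_symmetric[of h "Suc (2 * h)"] by (simp add: Suc_diff_le)
    finally show ?thesis using 1 by (simp add: card_slice h)
  qed
  then have "4 * card ?Z \<le> 3 * card (slice n)" using Z cc by linarith
  then have "real (4 * card ?Z) \<le> real (3 * card (slice n))" by (simp only: of_nat_le_iff)
  then show ?thesis by (simp add: rho_def card_slice divide_simps)
qed

text \<open>No exchange changes the sum of a constant vector. Its value is
  \<open>(n div 2) * c\<close>, where \<open>n div 2\<close> is invertible modulo \<open>p\<close>
  because \<open>p > n\<close>.\<close>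

lemma rho_constant:
  assumes p: "prime p" "p > n" and n: "n > 0" "even n" and a: "\<And>i. i < n \<Longrightarrow> a i = c" and c: "\<not> int p dvd c"
  shows "rho p n a = 0"
proof -
  have "\<not> int p dvd sum a S" if "S \<in> slice n" for S
  proof
    assume dvd: "int p dvd sum a S"
    have "sum a S = (\<Sum>i\<in>S. c)" using that by (intro sum.cong) (auto simp: slice_def intro: a)
    then have "int p dvd int (n div 2) * c" using dvd that by (simp add: slice_def)
    moreover have "prime (int p)" using p by simp
    ultimately have "int p dvd int (n div 2)" using c prime_dvd_multD by blast
    then have "p dvd n div 2" by (simp only: int_dvd_int_iff)
    moreover have "n div 2 > 0" using n by (auto elim: evenE)
    ultimately have "p \<le> n div 2" by (rule dvd_imp_le)
    then show False using p by linarith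
  qed
  then show ?thesis by (simp add: rho_def cong: conj_cong)
qed

definition bad_vecs :: "nat \<Rightarrow> nat \<Rightarrow> real \<Rightarrow> (nat \<Rightarrow> int) set" where
  "bad_vecs p n \<tau> = {a \<in> {..<n} \<rightarrow>\<^sub>E {0..<int p}. (\<exists>i<n. a i \<noteq> 0) \<and> rho p n a \<ge> \<tau>}"

text \<open>The two summands belong to the two kinds of exceptional vectors: those whose spread
  stays below \<open>2 * M * n\<close> are nearly constant and few enough for the factor
  \<open>3 / 4\<close> per row, and all others are peeled down to \<open>m = k * q\<close>
  coordinates.\<close>

lemma sum_bad_vecs_le:
  fixes \<tau> :: real
  assumes p: "prime p" "p > n" and n: "n > 0" "even n" and M: "M > 0" "M \<le> n" and k: "k > 0" and q: "q > 0"
    and Mq: "2 * real M * real n \<le> (real q)\<^sup>2" and m: "k * q \<le> n"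
    and small: "2 * layer_const / real p + 12 * layer_const / sqrt (real M) * (2 / real q) ^ k
      + 2 * exp (- real M / 16) \<le> \<tau> / 2"
    and small': "(2 / real q) ^ k \<le> 1 / 2"
  shows "(\<Sum>a\<in>bad_vecs p n \<tau>. rho p n a ^ (n - 1)) \<le>
    real p * (real n * real p) ^ M * (3 / 4) ^ (n - 1)
    + (2 * real k * (48 * layer_const * 2 ^ k / sqrt (real M))) ^ (n - k * q) * real p ^ (k * q)"
proof -
  have p0: "p > 0" using p by simp
  let ?V = "{..<n} \<rightarrow>\<^sub>E {0..<int p}"
  let ?N = "{a \<in> bad_vecs p n \<tau>. \<forall>t. spread p {..<n} a t \<le> 2 * real M * real n}"
  let ?Z = "bad_vecs p n \<tau> - ?N"
  have finV: "finite ?V" by (intro finite_PiE) auto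
  have fin: "finite (bad_vecs p n \<tau>)" by (rule finite_subset[OF _ finV]) (auto simp: bad_vecs_def)
  have "(\<Sum>a\<in>?N. rho p n a ^ (n - 1)) \<le> (\<Sum>a\<in>?N. (3 / 4) ^ (n - 1))"
  proof (intro sum_mono power_mono rho_nonneg)
    fix a assume "a \<in> ?N"
    then have a: "a \<in> ?V" "\<exists>i<n. a i \<noteq> 0" by (auto simp: bad_vecs_def)
    have lt: "\<bar>a i - a j\<bar> < int p" "\<bar>a i\<bar> < int p" if "i < n" "j < n" for i j
    proof -
      have "a i \<in> {0..<int p}" "a j \<in> {0..<int p}" using PiE_mem[OF a(1)] that by blast+
      then show "\<bar>a i - a j\<bar> < int p" "\<bar>a i\<bar> < int p" by auto
    qed
    have small_dvd: "x = 0" if "int p dvd x" "\<bar>x\<bar> < int p" for x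
      using that zdvd_imp_le[of "int p" "\<bar>x\<bar>"] by fastforce
    show "rho p n a \<le> 3 / 4"
    proof (cases "\<exists>i<n. \<exists>j<n. a i \<noteq> a j")
      case True
      then obtain i j where ij: "i < n" "j < n" "a i \<noteq> a j" by auto
      then have "\<not> int p dvd a i - a j" using small_dvd[of "a i - a j"] lt by auto
      then show ?thesis using rho_le_three_quarters[OF n ij(1,2)] by blast
    next
      case False
      obtain i where i: "i < n" "a i \<noteq> 0" using a by auto
      then have "\<not> int p dvd a i" using small_dvd[of "a i"] lt[of i i] by auto
      moreover have "a j = a i" if "j < n" for j using False i that by blast
      ultimately have "rho p n a = 0" by (intro rho_constant[OF p n, of a "a i"])
      then show ?thesis by simp
    qed
  qed
  also have "\<dots> = real (card ?N) * (3 / 4) ^ (n - 1)" by simp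
  also have "\<dots> \<le> real (p * (n * p) ^ M) * (3 / 4) ^ (n - 1)"
  proof (intro mult_right_mono)
    have "card ?N \<le> card {a \<in> ?V. \<exists>c\<in>{0..<int p}. card {j \<in> {..<n}. a j \<noteq> c} \<le> M}"
      using near_constant[OF p0 n(1)] finV by (intro card_mono) (auto simp: bad_vecs_def)
    also have "\<dots> \<le> p * (n * p) ^ M" by (rule card_near_constant_le[OF M(2)])
    finally show "real (card ?N) \<le> real (p * (n * p) ^ M)" by (simp only: of_nat_le_iff)
  qed auto
  finally have N: "(\<Sum>a\<in>?N. rho p n a ^ (n - 1)) \<le> real p * (real n * real p) ^ M * (3 / 4) ^ (n - 1)"
    by simp
  \<comment> \<open>Peeling matches one factor \<open>rho\<close> with each removed coordinate; the
    surplus factors are at most 1.\<close>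
  have "(\<Sum>a\<in>?Z. rho p n a ^ (n - 1)) \<le> (\<Sum>a\<in>?Z. rho p n a ^ (n - k * q))"
    using k q by (intro sum_mono power_decreasing diff_le_mono2 rho_nonneg rho_le_1) simp
  also have "\<dots> \<le> (2 * real k * (48 * layer_const * 2 ^ k / sqrt (real M))) ^ (n - k * q) * real p ^ (k * q)"
  proof (rule sum_power_le_peel[OF p0 k])
    fix a b assume a: "a \<in> ?Z" and b: "b \<subseteq> {..<n}" "card b > k * q"
    then obtain z where "spread p {..<n} a z > 2 * real M * real n" by (auto simp: not_le)
    then show "rho p n a \<le> 48 * layer_const * 2 ^ k / sqrt (real M) * (\<Sum>i\<in>b. wt p (blk k b) a i)"
      using a b by (intro rho_le_sum_wt[OF p(1) n M(1) k q Mq small small']) (auto simp: bad_vecs_def)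
  qed (use layer_const_pos M q m k in \<open>auto simp: bad_vecs_def rho_nonneg\<close>)
  finally have Z: "(\<Sum>a\<in>?Z. rho p n a ^ (n - 1)) \<le>
    (2 * real k * (48 * layer_const * 2 ^ k / sqrt (real M))) ^ (n - k * q) * real p ^ (k * q)" .
  have "(\<Sum>a\<in>bad_vecs p n \<tau>. rho p n a ^ (n - 1)) = (\<Sum>a\<in>?N. rho p n a ^ (n - 1)) + (\<Sum>a\<in>?Z. rho p n a ^ (n - 1))"
    using fin by (subst sum.subset_diff[of ?N]) auto
  then show ?thesis using N Z by linarith
qed

section \<open>Choice of the parameters\<close>

text \<open>Leibniz's harmonic triangle: its entries are integral combinations of \<open>1, 1/2, \<dots>, 1/(n + 1)\<close>.\<close>
lemma Leibniz_triangle_Ints: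
  assumes "k \<le> n" "\<And>i. 0 < i \<Longrightarrow> i \<le> Suc n \<Longrightarrow> i dvd D"
  shows "real D / (real (Suc n) * real (n choose k)) \<in> \<int>"
  using assms
proof (induction k arbitrary: n)
  case 0
  have "Suc n dvd D" using 0 by simp
  then have "real D / real (Suc n) \<in> \<int>"
    by (metis dvd_def Ints_of_nat nonzero_mult_div_cancel_left of_nat_mult nat.distinct(1) of_nat_eq_0_iff)
  then show ?case by simp
next
  case (Suc k)
  then obtain n' where n: "n = Suc n'" by (cases n) auto
  let ?x = "real (n' choose k)"
  have k: "k \<le> n'" using Suc n by simp
  have x: "?x > 0" using k by (simp add: zero_less_binomial)
  have "Suc k * (n choose Suc k) = n * (n' choose k)"
    unfolding n by (rule Suc_times_binomial)
  then have "real (Suc k) * real (n choose Suc k) = real n * ?x" by (metis of_nat_mult)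
  then have 1: "real (n choose Suc k) = real n * ?x / real (Suc k)" by (simp add: field_simps)
  have "(n - k) * (n choose k) = n * (n' choose k)"
    using binomial_absorb_comp[of n k] by (simp add: n)
  then have "real (n - k) * real (n choose k) = real n * ?x" by (metis of_nat_mult)
  then have "(real n - real k) * real (n choose k) = real n * ?x" using k n by (simp add: of_nat_diff)
  then have 2: "real (n choose k) = real n * ?x / (real n - real k)" using k n by (simp add: field_simps)
  \<comment> \<open>The defining recurrence of the triangle: an entry is the one above it minus its
    left neighbour.\<close>
  have eq: "real D / (real (Suc n) * real (n choose Suc k)) =
      real D / (real (Suc n') * ?x) - real D / (real (Suc n) * real (n choose k))"
    unfolding 1 2 using x k n by (simp add: divide_simps) (simp add: algebra_simps)
  show ?case unfolding eq
    using Suc.IH[of n'] Suc.IH[of n] Suc.prems k n by (intro Ints_diff) auto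
qed

text \<open>A weak form of Bertrand's postulate, sufficient since only polynomial size matters. With
  \<open>N = 2 * y^2 + 1\<close>, integrality in Leibniz's triangle gives \<open>4^(y^2)\<close> as
  a lower bound for every positive common multiple of 1, ..., \<open>N\<close>. If all primes up to
  \<open>N\<close> were at most \<open>y\<close>, some common multiple would be at most
  \<open>N^y\<close>, contradicting \<open>N < 4^y\<close>.\<close>

lemma ex_prime_between:
  assumes y: "y \<ge> (1 :: nat)"
  shows "\<exists>p. prime p \<and> y < p \<and> p \<le> 2 * y\<^sup>2 + 1"
proof (rule ccontr)
  assume none: "\<not> ?thesis"
  define N where "N = 2 * y\<^sup>2 + 1"
  define P where "P = {p. prime p \<and> p \<le> y}"
  have finP: "finite P" by (rule finite_subset[of _ "{..y}"]) (auto simp: P_def)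
  have "P \<subseteq> {1..y}" by (auto simp: P_def dest: prime_ge_1_nat)
  then have cardP: "card P \<le> y" using card_mono[of "{1..y}" P] by simp
  have "\<exists>e. p ^ e \<le> N \<and> N < p ^ (e + 1)" if "p \<in> P" for p
    using ex_power_ivl1[of p N] that by (auto simp: P_def N_def dest: prime_ge_2_nat)
  then obtain e where e: "\<And>p. p \<in> P \<Longrightarrow> p ^ e p \<le> N" "\<And>p. p \<in> P \<Longrightarrow> N < p ^ (e p + 1)" by metis
  \<comment> \<open>Each factor is the largest power of its prime not exceeding \<open>N\<close>. By
    \<open>none\<close> the primes in \<open>P\<close> are all primes up to \<open>N\<close>, so
    \<open>D\<close> is a common multiple of 1, ..., \<open>N\<close>.\<close>
  define D where "D = (\<Prod>p\<in>P. p ^ e p)"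
  have Dpos: "D > 0" unfolding D_def by (intro prod_pos) (auto simp: P_def dest: prime_gt_0_nat)
  have dvd: "i dvd D" if i: "0 < i" "i \<le> N" for i
  proof -
    have "i = (\<Prod>p\<in>prime_factors i. p ^ multiplicity p i)"
      using i prime_factorization_nat by blast
    also have "\<dots> dvd D" unfolding D_def
    proof (rule prod_dvd_prod_subset2[OF finP])
      have pP: "p \<in> P" if "p \<in> prime_factors i" for p
      proof -
        have "prime p" "p \<le> N" using that i dvd_imp_le[of p i] by auto
        then show ?thesis using none by (auto simp: P_def N_def not_less)
      qed
      then show "prime_factors i \<subseteq> P" by blast
      fix p assume p: "p \<in> prime_factors i"
      have "p ^ multiplicity p i \<le> i" by (rule dvd_imp_le[OF multiplicity_dvd i(1)])
      also have "\<dots> < p ^ (e p + 1)" using e(2)[OF pP[OF p]] i by simp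
      finally have "multiplicity p i < e p + 1"
        using p prime_gt_1_nat[of p] power_less_imp_less_exp by blast
      then show "p ^ multiplicity p i dvd p ^ e p" by (intro le_imp_power_dvd) simp
    qed
    finally show ?thesis .
  qed
  have pos: "real (Suc (2 * y\<^sup>2)) * real (2 * y\<^sup>2 choose y\<^sup>2) > 0"
    unfolding of_nat_mult[symmetric] of_nat_0_less_iff by (simp add: zero_less_binomial_iff)
  have "real D / (real (Suc (2 * y\<^sup>2)) * real (2 * y\<^sup>2 choose y\<^sup>2)) \<in> \<int>"
    by (rule Leibniz_triangle_Ints) (use dvd in \<open>auto simp: N_def\<close>)
  moreover have "real D / (real (Suc (2 * y\<^sup>2)) * real (2 * y\<^sup>2 choose y\<^sup>2)) > 0"
    using Dpos pos by (intro divide_pos_pos) auto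
  ultimately have "real D / (real (Suc (2 * y\<^sup>2)) * real (2 * y\<^sup>2 choose y\<^sup>2)) \<ge> 1"
    using Ints_nonzero_abs_ge1 by fastforce
  then have "real (Suc (2 * y\<^sup>2)) * real (2 * y\<^sup>2 choose y\<^sup>2) \<le> real D"
    using pos by (simp only: le_divide_eq_1_pos)
  moreover have "4 ^ (y\<^sup>2) \<le> real (Suc (2 * y\<^sup>2)) * real (2 * y\<^sup>2 choose y\<^sup>2)"
  proof -
    have "(4 :: nat) ^ (y\<^sup>2) = (\<Sum>k\<le>2 * y\<^sup>2. 2 * y\<^sup>2 choose k)"
      by (simp add: choose_row_sum power_mult)
    also have "\<dots> \<le> (\<Sum>k\<le>2 * y\<^sup>2. 2 * y\<^sup>2 choose y\<^sup>2)"
      using binomial_maximum[of "2 * y\<^sup>2"] by (intro sum_mono) simp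
    also have "\<dots> = Suc (2 * y\<^sup>2) * (2 * y\<^sup>2 choose y\<^sup>2)" by simp
    finally have "real (4 ^ (y\<^sup>2)) \<le> real (Suc (2 * y\<^sup>2) * (2 * y\<^sup>2 choose y\<^sup>2))"
      by (simp only: of_nat_le_iff)
    then show ?thesis by (simp only: of_nat_mult of_nat_power of_nat_numeral)
  qed
  moreover have "real D \<le> real N ^ y"
  proof -
    have "D \<le> (\<Prod>p\<in>P. N)" unfolding D_def using e by (intro prod_mono) auto
    also have "\<dots> = N ^ card P" by simp
    also have "\<dots> \<le> N ^ y" using cardP by (intro power_increasing) (auto simp: N_def)
    finally show ?thesis by (metis of_nat_le_iff of_nat_power)
  qed
  ultimately have "4 ^ (y\<^sup>2) \<le> real N ^ y" by linarith
  then have "(4 ^ y) ^ y \<le> real N ^ y" by (simp add: power2_eq_square power_mult)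
  then have "4 ^ y \<le> real N" using y by (subst (asm) power_mono_iff) auto
  moreover have "2 * (real y)\<^sup>2 + 1 < 4 ^ y" using y
  proof (induction y rule: dec_induct)
    case (step y)
    have "2 * (real (Suc y))\<^sup>2 + 1 \<le> 4 * (2 * (real y)\<^sup>2 + 1)"
    proof -
      have Suc: "(real (Suc y))\<^sup>2 = (real y)\<^sup>2 + 2 * real y + 1"
        by (simp add: power2_eq_square algebra_simps)
      have "real y \<le> (real y)\<^sup>2" using step by (intro self_le_power) auto
      moreover have "1 \<le> real y" using step by simp
      ultimately have "4 * real y \<le> 6 * (real y)\<^sup>2" by linarith
      then show ?thesis unfolding Suc by (simp add: algebra_simps)
    qed
    then show ?case using step.IH by simp
  qed simp
  ultimately show False by (simp add: N_def)
qed

section \<open>Asymptotic comparison of all losses and gains\<close>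

lemma eventually_sum_bad_vecs_le:
  fixes C :: nat
  shows "eventually (\<lambda>n. even n \<longrightarrow> (\<exists>p. prime p \<and> 
    (\<Sum>a\<in>bad_vecs p n (real n powr (- real C)). rho p n a ^ (n - 1)) \<le> real n powr (- real C))) at_top"
proof -
  define K where "K = layer_const"
  \<comment> \<open>As \<open>q \<ge> 2 * sqrt n\<close>, this makes \<open>(2 / q)^k\<close> at
    most \<open>n^(-k/2) = n^(-(C + 1))\<close>. The exponent \<open>c\<close> bounds the prime:
    with \<open>y = n^(C + 2)\<close> one has \<open>p \<le> 2 * y^2 + 1 \<le> n^c\<close>.\<close>
  define k where "k = 2 * (C + 1)"
  define c where "c = real (2 * C + 7)"
  define K5 where "K5 = 2 * real k * (48 * K * 2 ^ k)"
  \<comment> \<open>The block size \<open>q\<close> is the least integer with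
    \<open>q \<ge> sqrt 2 * n^(3/4)\<close>, that is \<open>q^2 \<ge> 2 * sqrt n * n\<close>, as
    \<open>2 * M * n \<le> q^2\<close> demands.\<close>
  define M where "M n = nat \<lfloor>sqrt (real n)\<rfloor>" for n :: nat
  define q where "q n = nat \<lceil>sqrt 2 * real n powr (3 / 4)\<rceil>" for n :: nat
  \<comment> \<open>\<open>- E n\<close> is the exponent of \<open>n\<close> in the peeled term:
    \<open>-1/8\<close> for each of the \<open>n - k * q\<close> removed coordinates and
    \<open>c\<close> for each of the \<open>k * q\<close> others.\<close>
  define E :: "nat \<Rightarrow> real" where "E n = real n / 8 - real (k * q n) * (1 / 8 + c)" for n
  have K: "K > 0" unfolding K_def by (rule layer_const_pos)
  have k: "k > 0" by (simp add: k_def)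
  have K5: "K5 > 0" using K k by (simp add: K5_def)
  have c: "c > 0" by (simp add: c_def)
  have C0: "real C \<ge> 0" by simp
  have Mb: "real (M n) \<le> sqrt (real n)" "real (M n) \<ge> sqrt (real n) - 1" for n
    unfolding M_def by (simp_all add: of_nat_nat)
  have qb: "real (q n) \<ge> sqrt 2 * real n powr (3 / 4)" "real (q n) \<le> sqrt 2 * real n powr (3 / 4) + 1" for n
  proof -
    have "sqrt 2 * real n powr (3 / 4) \<ge> 0" by simp
    then have "0 \<le> \<lceil>sqrt 2 * real n powr (3 / 4)\<rceil>" by (metis ceiling_mono ceiling_zero)
    then have "real (q n) = of_int \<lceil>sqrt 2 * real n powr (3 / 4)\<rceil>" by (simp add: q_def)
    then show "real (q n) \<ge> sqrt 2 * real n powr (3 / 4)" "real (q n) \<le> sqrt 2 * real n powr (3 / 4) + 1"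
      by linarith+
  qed
  \<comment> \<open>The middle inequality yields \<open>sqrt (M n) \<ge> n^(1/4) / 4\<close>, the
    last one \<open>q n \<ge> 2 * sqrt n\<close>.\<close>
  have ev1: "eventually (\<lambda>n::nat. real n \<ge> 2 \<and> sqrt (real n) / 16 \<le> sqrt (real n) - 1
     \<and> 2 * sqrt (real n) \<le> sqrt 2 * real n powr (3 / 4)) at_top"
    by (intro eventually_conj; real_asymp)
  have ev2: "eventually (\<lambda>n::nat. (real k * (sqrt 2 * real n powr (3 / 4) + 1)) * (1 / 8 + c) + (real C + 1)
     \<le> real n / 8) at_top"
    using k c by real_asymp
  have ev3: "eventually (\<lambda>n::nat. 4 * K5 * real n powr (- 1 / 4) \<le> real n powr (- 1 / 8)) at_top"
    using K5 by real_asymp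
  have ev4: "eventually (\<lambda>n::nat. c * ln (real n) + sqrt (real n) * ((1 + c) * ln (real n)) - (real n - 1) * ln (4 / 3)
     \<le> - (real C + 1) * ln (real n)) at_top"
    using c C0 by real_asymp
  have ev5: "eventually (\<lambda>n::nat. 2 * exp (- (sqrt (real n) - 1) / 16) \<le> real n powr (- (real C + 1))) at_top"
    using C0 by real_asymp
  \<comment> \<open>Room for the three errors in \<open>small\<close>: \<open>2 * K\<close> for the
    term with \<open>1 / p\<close>, \<open>12 * K\<close> for the one with \<open>(2 / q)^k\<close>,
    and 1 for the exponential.\<close>
  have ev6: "eventually (\<lambda>n::nat. (14 * K + 1) * real n powr (- (real C + 1)) \<le> real n powr (- real C) / 2) at_top"
    using K C0 by real_asymp
  have ev7: "eventually (\<lambda>n::nat. real n powr (- (real C + 1)) \<le> 1 / 2) at_top"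
    using C0 by real_asymp
  have ev8: "eventually (\<lambda>n::nat. 2 * real n powr (- (real C + 1)) \<le> real n powr (- real C)) at_top"
    using C0 by real_asymp
  have ev9: "eventually (\<lambda>n::nat. real n powr (- real (C + 2)) \<le> real n powr (- (real C + 1))) at_top"
    by (auto intro!: eventually_sequentiallyI[of 1] powr_mono)
  from ev1 ev2 ev3 ev4 ev5 ev6 ev7 ev8 ev9 show ?thesis
  proof eventually_elim
    case (elim n)
    have n2: "n \<ge> 2" using elim(1) by simp
    then have n0: "n > 0" by simp
    show ?case
    proof
      assume even: "even n"
      obtain p where p: "prime p" "n ^ (C + 2) < p" "p \<le> 2 * (n ^ (C + 2))\<^sup>2 + 1"
        using ex_prime_between[of "n ^ (C + 2)"] n0 by auto
      have "n ^ 1 \<le> n ^ (C + 2)" using n0 by (intro power_increasing) auto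
      then have pn: "p > n" using p(2) unfolding power_one_right by linarith
      have p_ub: "real p \<le> real n powr c"
      proof -
        have "1 \<le> (n ^ (C + 2))\<^sup>2" using n0 by simp
        then have "2 * (n ^ (C + 2))\<^sup>2 + 1 \<le> 4 * (n ^ (C + 2))\<^sup>2" by linarith
        also have "\<dots> \<le> n\<^sup>2 * (n ^ (C + 2))\<^sup>2"
          using power_mono[OF n2, of 2] by (intro mult_right_mono) auto
        also have "\<dots> = n ^ (2 * C + 6)" 
        proof -
          have "2 * C + 6 = 2 + (C + 2) * 2" by simp
          then show ?thesis by (simp only: power_add power_mult)
        qed
        also have "\<dots> \<le> n ^ (2 * C + 7)" using n0 by (intro power_increasing) auto
        finally have "p \<le> n ^ (2 * C + 7)" using p by linarith
        then have "real p \<le> real n ^ (2 * C + 7)" by (metis of_nat_le_iff of_nat_power)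
        then show ?thesis using n0 by (simp add: c_def powr_realpow[symmetric] del: of_nat_add)
      qed
      have lnp: "ln (real p) \<le> c * ln (real n)"
        using ln_mono[OF p_ub] pn n0 by (simp add: ln_powr)
      have sqrt4: "sqrt (real n) \<ge> 1" using n0 by simp
      have M: "M n > 0" "M n \<le> n"
      proof -
        show "M n > 0" using Mb(2)[of n] elim(1) sqrt4 by (cases "M n = 0") auto
        have "sqrt (real n) \<le> real n" using n0 by (intro real_le_lsqrt) (auto simp: power2_eq_square)
        then show "M n \<le> n" using Mb(1)[of n] by linarith
      qed
      have q: "2 / real (q n) \<le> real n powr (- 1 / 2)" "q n > 0"
      proof -
        have "2 * sqrt (real n) \<le> real (q n)" using elim(1) qb(1)[of n] by linarith
        moreover have "sqrt (real n) > 0" using n0 by simp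
        ultimately show "q n > 0" by (metis gr0I mult_pos_pos not_less of_nat_0 zero_less_numeral)
        then show "2 / real (q n) \<le> real n powr (- 1 / 2)"
          using \<open>2 * sqrt (real n) \<le> real (q n)\<close> n0
          by (simp add: powr_minus_divide powr_half_sqrt field_simps)
      qed
      have qk: "(2 / real (q n)) ^ k \<le> real n powr (- (real C + 1))"
      proof -
        have "(2 / real (q n)) ^ k \<le> (real n powr (- 1 / 2)) ^ k"
          using q by (intro power_mono) auto
        also have "\<dots> = (real n powr (- 1 / 2)) powr real k"
          using n0 by (subst powr_realpow) auto
        also have "\<dots> = real n powr (- 1 / 2 * real k)" by (rule powr_powr)
        also have "- 1 / 2 * real k = - (real C + 1)" by (simp add: k_def field_simps)
        finally show ?thesis .
      qed
      have Mq: "2 * real (M n) * real n \<le> (real (q n))\<^sup>2"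
      proof -
        have "2 * real (M n) * real n \<le> 2 * sqrt (real n) * real n"
          using Mb(1)[of n] by (intro mult_right_mono mult_left_mono) auto
        also have "\<dots> = 2 * (real n powr (1 / 2) * real n powr 1)" using n0 by (simp add: powr_half_sqrt)
        also have "\<dots> = (sqrt 2 * real n powr (3 / 4))\<^sup>2"
        proof -
          have x: "real n powr (3 / 4) * real n powr (3 / 4) = real n powr (1 / 2) * real n powr 1"
            by (simp only: powr_add[symmetric]) simp
          show ?thesis
            by (simp only: power_mult_distrib power2_eq_square[of "real n powr (3 / 4)"] x) simp
        qed
        also have "\<dots> \<le> (real (q n))\<^sup>2" using qb(1)[of n] by (intro power_mono) auto
        finally show ?thesis .
      qed
      have kq: "real (k * q n) \<le> real k * (sqrt 2 * real n powr (3 / 4) + 1)"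
        using qb(2)[of n] by (simp add: mult_left_mono)
      have E: "E n \<ge> real C + 1"
        using mult_right_mono[OF kq, of "1 / 8 + c"] c elim(2) by (simp add: E_def)
      have m: "k * q n \<le> n"
      proof -
        have "real (k * q n) * (1 / 8) \<le> real (k * q n) * (1 / 8 + c)" using c by (intro mult_left_mono) auto
        then have "real (k * q n) \<le> real n" using E by (simp add: E_def)
        then show ?thesis by linarith
      qed
      have small: "2 * layer_const / real p + 12 * layer_const / sqrt (real (M n)) * (2 / real (q n)) ^ k
        + 2 * exp (- real (M n) / 16) \<le> real n powr (- real C) / 2"
      proof -
        let ?\<epsilon> = "real n powr (- (real C + 1))"
        have "1 / real p \<le> real n powr (- real (C + 2))"
        proof -
          have "real n ^ (C + 2) \<le> real p" using p by (metis less_imp_le of_nat_le_iff of_nat_power)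
          then have "1 / real p \<le> 1 / real n ^ (C + 2)" using n0 by (intro divide_left_mono) (auto intro!: mult_pos_pos simp: p prime_gt_0_nat)
          moreover have "real n > 0" using n0 by simp
          ultimately show ?thesis by (simp only: powr_minus_divide powr_realpow)
        qed
        then have "2 * K * (1 / real p) \<le> 2 * K * ?\<epsilon>" using elim(9) K by (intro mult_left_mono) auto
        moreover have "12 * K / sqrt (real (M n)) * (2 / real (q n)) ^ k \<le> 12 * K / 1 * ?\<epsilon>"
          using K M qk by (intro mult_mono divide_left_mono) auto
        moreover have "2 * exp (- real (M n) / 16) \<le> ?\<epsilon>"
          using elim(5) Mb(2)[of n] by (smt (verit) divide_right_mono exp_le_cancel_iff)
        moreover have "(14 * K + 1) * ?\<epsilon> = 2 * K * ?\<epsilon> + 12 * K / 1 * ?\<epsilon> + ?\<epsilon>"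
          by (simp add: algebra_simps)
        moreover have "2 * layer_const / real p = 2 * K * (1 / real p)" by (simp add: K_def)
        ultimately show ?thesis using elim(6) unfolding K_def by linarith
      qed
      have "(\<Sum>a\<in>bad_vecs p n (real n powr (- real C)). rho p n a ^ (n - 1)) \<le>
        real p * (real n * real p) ^ M n * (3 / 4) ^ (n - 1)
        + (2 * real k * (48 * layer_const * 2 ^ k / sqrt (real (M n)))) ^ (n - k * q n) * real p ^ (k * q n)"
        by (rule sum_bad_vecs_le[OF p(1) pn n0 even M k q(2) Mq m small]) (use qk elim(7) in linarith)
      also have "real p * (real n * real p) ^ M n * (3 / 4) ^ (n - 1) \<le> real n powr (- (real C + 1))"
      proof -
        have p0: "real p > 0" using pn by simp
        have "(3 / 4) ^ (n - 1) = exp (- (real n - 1) * ln (4 / 3))"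
        proof -
          have "exp (- ln (4 / 3) :: real) = 3 / 4" by (simp add: exp_minus)
          then have "(3 / 4 :: real) ^ (n - 1) = exp (- ln (4 / 3)) ^ (n - 1)" by (simp only:)
          also have "\<dots> = exp (real (n - 1) * - ln (4 / 3))" by (rule exp_of_nat_mult[symmetric])
          also have "real (n - 1) * - ln (4 / 3) = - (real n - 1) * ln (4 / 3 :: real)"
            using n0 by (simp add: of_nat_diff algebra_simps)
          finally show ?thesis .
        qed
        moreover have "(real n * real p) ^ M n = exp (real (M n) * (ln (real n) + ln (real p)))"
          using n0 p0 by (simp add: exp_of_nat_mult exp_add)
        ultimately have "real p * (real n * real p) ^ M n * (3 / 4) ^ (n - 1) =
            exp (ln (real p) + real (M n) * (ln (real n) + ln (real p)) + - (real n - 1) * ln (4 / 3))"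
          using p0 by (simp only: exp_add exp_ln)
        also have "\<dots> \<le> exp (- (real C + 1) * ln (real n))"
        proof -
          have "real (M n) * (ln (real n) + ln (real p)) \<le> sqrt (real n) * ((1 + c) * ln (real n))"
            using Mb(1)[of n] lnp n0 p0 pn by (intro mult_mono) (auto simp: algebra_simps)
          then have "ln (real p) + real (M n) * (ln (real n) + ln (real p)) + - (real n - 1) * ln (4 / 3)
              \<le> - (real C + 1) * ln (real n)"
            using elim(4) lnp mult_minus_left[of "real n - 1" "ln (4 / 3)"] by linarith
          then show ?thesis by (simp only: exp_le_cancel_iff)
        qed
        also have "\<dots> = real n powr (- (real C + 1))" using n0 by (simp add: powr_def)
        finally show ?thesis .
      qed
      also have "(2 * real k * (48 * layer_const * 2 ^ k / sqrt (real (M n)))) ^ (n - k * q n) * real p ^ (k * q n)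
        \<le> real n powr (- (real C + 1))"
      proof -
        have "2 * real k * (48 * layer_const * 2 ^ k / sqrt (real (M n))) = K5 / sqrt (real (M n))"
          by (simp add: K5_def K_def)
        also have "\<dots> \<le> K5 / (real n powr (1 / 4) / 4)"
        proof (intro divide_left_mono)
          have "real n powr (1 / 4) / 4 = sqrt (sqrt (real n) / 16)"
            using n0 by (simp add: real_sqrt_divide powr_half_sqrt[symmetric] powr_powr)
          also have "\<dots> \<le> sqrt (real (M n))" using elim(1) Mb(2)[of n] by simp
          finally show "real n powr (1 / 4) / 4 \<le> sqrt (real (M n))" .
        qed (use K5 M n0 in auto)
        also have "\<dots> = 4 * K5 * real n powr (- 1 / 4)" by (simp add: powr_minus_divide)
        also have "\<dots> \<le> real n powr (- 1 / 8)" by (rule elim(3))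
        finally have base: "2 * real k * (48 * layer_const * 2 ^ k / sqrt (real (M n))) \<le> real n powr (- 1 / 8)" .
        have "(2 * real k * (48 * layer_const * 2 ^ k / sqrt (real (M n)))) ^ (n - k * q n) * real p ^ (k * q n)
           \<le> (real n powr (- 1 / 8)) ^ (n - k * q n) * (real n powr c) ^ (k * q n)"
          using base p_ub K by (intro mult_mono power_mono) (auto simp: K_def)
        also have "\<dots> = real n powr (- E n)"
          using n0 m by (simp add: powr_realpow[symmetric] powr_powr powr_add[symmetric] E_def of_nat_diff algebra_simps del: of_nat_mult)
        also have "\<dots> \<le> real n powr (- (real C + 1))" using E n2 by (intro powr_mono) auto
        finally show ?thesis .
      qed
      also have "real n powr (- (real C + 1)) + real n powr (- (real C + 1)) \<le> real n powr (- real C)"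
        using elim(8) by simp
      finally show "\<exists>p. prime p \<and> 
        (\<Sum>a\<in>bad_vecs p n (real n powr (- real C)). rho p n a ^ (n - 1)) \<le> real n powr (- real C)"
        using p(1) by auto
    qed
  qed
qed

section \<open>Singular matrices\<close>

definition incidence_mat :: "nat \<Rightarrow> (nat \<Rightarrow> nat set) \<Rightarrow> int mat" where
  "incidence_mat n S = mat n n (\<lambda>(i, j). if j \<in> S i then 1 else 0)"

lemma incidence_mat_carrier [simp]: "incidence_mat n S \<in> carrier_mat n n"
  by (simp add: incidence_mat_def)

lemma sum_incidence:
  assumes "i < n" "S i \<subseteq> {..<n}"
  shows "(\<Sum>j<n. incidence_mat n S $$ (i, j) * A j) = sum A (S i)"
proof -
  have "(\<Sum>j<n. incidence_mat n S $$ (i, j) * A j) = (\<Sum>j<n. if j \<in> S i then A j else 0)"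
    using assms by (intro sum.cong) (auto simp: incidence_mat_def)
  also have "\<dots> = sum A (S i)"
    using assms by (intro sum.mono_neutral_cong_right) auto
  finally show ?thesis .
qed

text \<open>Take a left kernel vector \<open>c\<close> and \<open>l\<close> with
  \<open>c l \<noteq> 0\<close>: if \<open>A\<close> is orthogonal to the other rows, then
  \<open>c l * sum A (S l) = 0\<close>. Phrasing dependence through test vectors avoids division in
  the integers.\<close>

lemma dependent_row:
  assumes S: "\<And>i. i < n \<Longrightarrow> S i \<subseteq> {..<n}" and det: "det (incidence_mat n S) = 0"
  shows "\<exists>l<n. \<forall>A::nat \<Rightarrow> int. (\<forall>i<n. i \<noteq> l \<longrightarrow> sum A (S i) = 0) \<longrightarrow> sum A (S l) = 0"
proof -
  let ?N = "incidence_mat n S"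
  have "det (transpose_mat ?N) = 0" using det det_transpose[OF incidence_mat_carrier, of n S] by simp
  then obtain c where c: "c \<in> carrier_vec n" "c \<noteq> 0\<^sub>v n" "transpose_mat ?N *\<^sub>v c = 0\<^sub>v n"
    using det_0_iff_vec_prod_zero[of "transpose_mat ?N" n] by auto
  then obtain l where l: "l < n" "c $ l \<noteq> 0" by (metis carrier_vecD eq_vecI index_zero_vec)
  have col: "(\<Sum>i<n. c $ i * ?N $$ (i, j)) = 0" if j: "j < n" for j
  proof -
    have "(transpose_mat ?N *\<^sub>v c) $ j = (\<Sum>i<n. c $ i * ?N $$ (i, j))"
      using j c(1) by (simp add: scalar_prod_def incidence_mat_def lessThan_atLeast0 mult.commute)
    then show ?thesis using c(3) j by simp
  qed
  have "sum A (S l) = 0" if A: "\<forall>i<n. i \<noteq> l \<longrightarrow> sum A (S i) = 0" for A :: "nat \<Rightarrow> int"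
  proof -
    have "0 = (\<Sum>j<n. (\<Sum>i<n. c $ i * ?N $$ (i, j)) * A j)" using col by simp
    also have "\<dots> = (\<Sum>i<n. c $ i * (\<Sum>j<n. ?N $$ (i, j) * A j))"
      unfolding sum_distrib_left sum_distrib_right by (subst sum.swap) (simp add: mult.assoc)
    also have "\<dots> = (\<Sum>i<n. if i = l then c $ l * sum A (S l) else 0)"
      using A S by (intro sum.cong refl) (auto simp: sum_incidence)
    also have "\<dots> = c $ l * sum A (S l)" using l by simp
    finally show ?thesis using l by simp
  qed
  then show ?thesis using l by blast
qed

text \<open>Emptying row \<open>l\<close> makes the matrix singular, so it has a nonzero integral
  kernel vector. Dividing by the gcd of its entries ensures that it does not vanish modulo
  \<open>p\<close>.\<close>

lemma ex_primitive_kernel_vector: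
  assumes S: "\<And>i. i < n \<Longrightarrow> S i \<subseteq> {..<n}" and l: "l < n" and p: "prime p"
  shows "\<exists>A::nat \<Rightarrow> int. (\<exists>j<n. \<not> int p dvd A j) \<and> (\<forall>i<n. i \<noteq> l \<longrightarrow> sum A (S i) = 0)"
proof -
  define S' where "S' = S(l := {})"
  let ?N = "incidence_mat n S'"
  have S': "S' i \<subseteq> {..<n}" if "i < n" for i using S that by (auto simp: S'_def)
  have "?N = mat\<^sub>r n n (\<lambda>i. if i = l then 0\<^sub>v n else row ?N i)"
    by (rule eq_matI) (auto simp: incidence_mat_def S'_def)
  then have "det ?N = 0" using det_row_0[OF l, of "row ?N"] by simp
  then obtain v where v: "v \<in> carrier_vec n" "v \<noteq> 0\<^sub>v n" "?N *\<^sub>v v = 0\<^sub>v n"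
    using det_0_iff_vec_prod_zero[of ?N n] by auto
  define g where "g = Gcd ((($) v) ` {..<n})"
  obtain j0 where j0: "j0 < n" "v $ j0 \<noteq> 0" using v by (metis carrier_vecD eq_vecI index_zero_vec)
  have g0: "g \<noteq> 0" using j0 unfolding g_def Gcd_0_iff by auto
  have gdvd: "g dvd v $ j" if "j < n" for j using that by (auto simp: g_def)
  define A where "A j = v $ j div g" for j
  have vA: "v $ j = g * A j" if "j < n" for j using gdvd[OF that] by (simp add: A_def)
  have "\<exists>j<n. \<not> int p dvd A j"
  proof (rule ccontr)
    assume "\<not> ?thesis"
    then have "g * int p dvd v $ j" if "j < n" for j using that by (simp add: vA)
    then have "g * int p dvd g" unfolding g_def[symmetric] by (subst g_def) (auto intro!: Gcd_greatest)
    then have "int p dvd 1" using g0 by (metis dvd_mult_cancel_left mult.right_neutral)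
    then show False using p by (simp add: prime_nat_iff)
  qed
  moreover have "sum A (S i) = 0" if i: "i < n" "i \<noteq> l" for i
  proof -
    have "(?N *\<^sub>v v) $ i = (\<Sum>j<n. ?N $$ (i, j) * v $ j)"
      using i v(1) by (simp add: scalar_prod_def incidence_mat_def lessThan_atLeast0)
    also have "\<dots> = sum (($) v) (S' i)" using i S' by (simp add: sum_incidence)
    also have "\<dots> = sum (\<lambda>j. g * A j) (S i)"
      using i S by (intro sum.cong) (auto simp: S'_def intro!: vA)
    also have "\<dots> = g * sum A (S i)" by (simp add: sum_distrib_left)
    finally show ?thesis using v(3) i g0 by simp
  qed
  ultimately show ?thesis by blast
qed

text \<open>The choice refers only to the rows other than \<open>l\<close>, so the vector does not
  depend on row \<open>l\<close>; this is what later permits conditioning. Reduction and restriction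
  place it in the finite set of residue vectors that is summed over.\<close>

definition kernel_mod :: "nat \<Rightarrow> nat \<Rightarrow> nat \<Rightarrow> (nat \<Rightarrow> nat set) \<Rightarrow> nat \<Rightarrow> int" where
  "kernel_mod p n l S = restrict (\<lambda>j. (SOME A :: nat \<Rightarrow> int. (\<exists>j<n. \<not> int p dvd A j) \<and>
     (\<forall>i<n. i \<noteq> l \<longrightarrow> sum A (S i) = 0)) j mod int p) {..<n}"

lemma kernel_mod_cong:
  assumes "\<And>i. i < n \<Longrightarrow> i \<noteq> l \<Longrightarrow> S i = S' i"
  shows "kernel_mod p n l S = kernel_mod p n l S'"
proof -
  have "(\<forall>i<n. i \<noteq> l \<longrightarrow> sum A (S i) = 0) \<longleftrightarrow> (\<forall>i<n. i \<noteq> l \<longrightarrow> sum A (S' i) = 0)" for A :: "nat \<Rightarrow> int"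
    using assms by auto
  then show ?thesis by (simp add: kernel_mod_def)
qed

lemma kernel_mod:
  assumes S: "\<And>i. i < n \<Longrightarrow> S i \<subseteq> {..<n}" and l: "l < n" and p: "prime p"
  shows "kernel_mod p n l S \<in> {..<n} \<rightarrow>\<^sub>E {0..<int p}" "\<exists>j<n. kernel_mod p n l S j \<noteq> 0"
    "\<And>i. i < n \<Longrightarrow> i \<noteq> l \<Longrightarrow> int p dvd sum (kernel_mod p n l S) (S i)"
    "(\<And>A::nat \<Rightarrow> int. (\<forall>i<n. i \<noteq> l \<longrightarrow> sum A (S i) = 0) \<Longrightarrow> sum A (S l) = 0) \<Longrightarrow>
      int p dvd sum (kernel_mod p n l S) (S l)"
proof -
  define A where "A = (SOME A :: nat \<Rightarrow> int. (\<exists>j<n. \<not> int p dvd A j) \<and>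
     (\<forall>i<n. i \<noteq> l \<longrightarrow> sum A (S i) = 0))"
  have A: "\<exists>j<n. \<not> int p dvd A j" "\<forall>i<n. i \<noteq> l \<longrightarrow> sum A (S i) = 0"
    using someI_ex[OF ex_primitive_kernel_vector[of n S l p, OF S l p]] by (auto simp: A_def)
  have k: "kernel_mod p n l S = restrict (\<lambda>j. A j mod int p) {..<n}"
    by (simp add: kernel_mod_def A_def)
  have p0: "p > 0" using p prime_gt_0_nat by blast
  show "kernel_mod p n l S \<in> {..<n} \<rightarrow>\<^sub>E {0..<int p}" using p0 by (auto simp: k)
  show "\<exists>j<n. kernel_mod p n l S j \<noteq> 0" using A(1) by (auto simp: k dvd_eq_mod_eq_0)
  have red: "int p dvd sum (kernel_mod p n l S) (S i)" if "i < n" "sum A (S i) = 0" for i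
  proof -
    have "sum (kernel_mod p n l S) (S i) = (\<Sum>j\<in>S i. A j mod int p)"
      using S[OF that(1)] by (intro sum.cong) (auto simp: k)
    also have "\<dots> mod int p = sum A (S i) mod int p" by (rule mod_sum_eq)
    finally show ?thesis using that(2) by (simp add: dvd_eq_mod_eq_0)
  qed
  show "int p dvd sum (kernel_mod p n l S) (S i)" if "i < n" "i \<noteq> l" for i
    using red[OF that(1)] A(2) that by blast
  show "int p dvd sum (kernel_mod p n l S) (S l)"
    if "\<And>A::nat \<Rightarrow> int. (\<forall>i<n. i \<noteq> l \<longrightarrow> sum A (S i) = 0) \<Longrightarrow> sum A (S l) = 0"
    using red[OF l] that A(2) by blast
qed

section \<open>Rows as random sets, and the probability of a dependent row\<close>

definition ones :: "nat \<Rightarrow> real vec \<Rightarrow> nat set" where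
  "ones n v = {j. j < n \<and> v $ j = 1}"

lemma bij_betw_ones:
  assumes "even n"
  shows "bij_betw (ones n) (balanced_vecs n) (slice n)"
proof (rule bij_betw_byWitness[where f' = "\<lambda>S. vec n (\<lambda>j. if j \<in> S then 1 else 0)"])
  have compl: "card {j. j < n \<and> j \<notin> S} = n - card S" if "S \<subseteq> {..<n}" for S
  proof -
    have "{j. j < n \<and> j \<notin> S} = {..<n} - S" by auto
    then show ?thesis using that finite_subset[OF that] by (simp add: card_Diff_subset)
  qed
  show "\<forall>v\<in>balanced_vecs n. vec n (\<lambda>j. if j \<in> ones n v then 1 else 0) = v"
    by (auto simp: balanced_vecs_def ones_def intro!: eq_vecI)
  show "\<forall>S\<in>slice n. ones n (vec n (\<lambda>j. if j \<in> S then 1 else 0)) = S"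
    by (auto simp: slice_def ones_def split: if_splits)
  show "ones n ` balanced_vecs n \<subseteq> slice n"
  proof (rule image_subsetI)
    fix v assume v: "v \<in> balanced_vecs n"
    have "{j. j < n \<and> v $ j = 0} = {j. j < n \<and> j \<notin> ones n v}"
      using v by (auto simp: balanced_vecs_def ones_def)
    moreover have sub: "ones n v \<subseteq> {..<n}" by (auto simp: ones_def)
    ultimately have "n div 2 = n - card (ones n v)" using v compl by (simp add: balanced_vecs_def)
    moreover have "card (ones n v) \<le> n" using card_mono[OF _ sub] by simp
    ultimately show "ones n v \<in> slice n" using assms sub by (auto simp: slice_def)
  qed
  show "(\<lambda>S. vec n (\<lambda>j. if j \<in> S then 1 else 0)) ` slice n \<subseteq> balanced_vecs n"
  proof (rule image_subsetI)
    fix S assume S: "S \<in> slice n"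
    have "{j. j < n \<and> vec n (\<lambda>j. if j \<in> S then 1 else 0 :: real) $ j = 0} = {j. j < n \<and> j \<notin> S}"
      by auto
    then have "card {j. j < n \<and> vec n (\<lambda>j. if j \<in> S then 1 else 0 :: real) $ j = 0} = n div 2"
      using S compl[of S] assms by (auto simp: slice_def)
    then show "vec n (\<lambda>j. if j \<in> S then 1 else 0) \<in> balanced_vecs n"
      by (auto simp: balanced_vecs_def)
  qed
qed

lemma prob_balanced_eq_rho:
  assumes "even n"
  shows "measure_pmf.prob (pmf_of_set (balanced_vecs n)) {v. int p dvd sum a (ones n v)} = rho p n a"
proof -
  have bij: "bij_betw (ones n) (balanced_vecs n) (slice n)" by (rule bij_betw_ones[OF assms])
  have "bij_betw (ones n) {v \<in> balanced_vecs n. int p dvd sum a (ones n v)} {S \<in> slice n. int p dvd sum a S}"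
  proof -
    have "ones n ` {v \<in> balanced_vecs n. int p dvd sum a (ones n v)} = {S \<in> ones n ` balanced_vecs n. int p dvd sum a S}"
      by auto
    then show ?thesis using bij by (auto simp: bij_betw_def intro: inj_on_subset)
  qed
  then have "card {v \<in> balanced_vecs n. int p dvd sum a (ones n v)} = card {S \<in> slice n. int p dvd sum a S}"
    by (rule bij_betw_same_card)
  moreover have "balanced_vecs n \<inter> {v. int p dvd sum a (ones n v)} = {v \<in> balanced_vecs n. int p dvd sum a (ones n v)}"
    by auto
  ultimately show ?thesis
    using bij_betw_same_card[OF bij]
    by (simp add: measure_pmf_of_set finite_balanced_vecs balanced_vecs_nonempty rho_def)
qed

lemma not_invertible_imp_det_0:
  fixes A :: "'a :: field mat"
  assumes A: "A \<in> carrier_mat n n" and "\<not> invertible_mat A"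
  shows "det A = 0"
proof (rule ccontr)
  assume "det A \<noteq> 0"
  from det_non_zero_imp_unit[OF A this, of "()"]
  obtain B where "B \<in> carrier_mat n n" "B * A = 1\<^sub>m n" "A * B = 1\<^sub>m n"
    unfolding Units_def ring_mat_def by auto
  then have "invertible_mat A"
    using A by (auto simp: invertible_mat_def inverts_mat_def)
  then show False using assms by simp
qed

lemma singular_imp_dependent_row:
  assumes x: "\<And>i. i < n \<Longrightarrow> x i \<in> balanced_vecs n" and inv: "\<not> invertible_mat (mat\<^sub>r n n x)" and p: "prime p"
  shows "\<exists>l<n. int p dvd sum (kernel_mod p n l (\<lambda>i. ones n (x i))) (ones n (x l))"
proof -
  let ?S = "\<lambda>i. ones n (x i)"
  have S: "?S i \<subseteq> {..<n}" for i by (auto simp: ones_def)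
  \<comment> \<open>The determinant commutes with the embedding of the integers, so singularity over
    the reals becomes singularity over the integers.\<close>
  have "map_mat of_int (incidence_mat n ?S) = mat\<^sub>r n n x"
  proof (rule eq_matI)
    fix i j assume "i < dim_row (mat\<^sub>r n n x)" "j < dim_col (mat\<^sub>r n n x)"
    then have ij: "i < n" "j < n" by auto
    then have "x i $ j \<in> {0, 1}" using x[of i] by (auto simp: balanced_vecs_def)
    then show "map_mat of_int (incidence_mat n ?S) $$ (i, j) = mat\<^sub>r n n x $$ (i, j)"
      using ij by (auto simp: incidence_mat_def ones_def)
  qed (auto simp: incidence_mat_def)
  moreover have "det (mat\<^sub>r n n x) = 0" by (rule not_invertible_imp_det_0[OF mat_row_carrierI inv])
  ultimately have "real_of_int (det (incidence_mat n ?S)) = 0" by (metis of_int_hom.hom_det)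
  then have "det (incidence_mat n ?S) = 0" by simp
  then obtain l where "l < n" "\<forall>A::nat \<Rightarrow> int. (\<forall>i<n. i \<noteq> l \<longrightarrow> sum A (?S i) = 0) \<longrightarrow> sum A (?S l) = 0"
    using dependent_row[of n ?S] S by blast
  then show ?thesis using kernel_mod(4)[of n ?S l p] S p by blast
qed

text \<open>If the kernel vector is exceptional, a union bound over its possible values uses only
  that the other rows are orthogonal to it. Otherwise row \<open>l\<close> is independent of the
  kernel vector and orthogonal to it with probability below \<tau>.\<close>

lemma prob_dependent_row_le:
  fixes \<tau> :: real
  assumes n: "even n" and l: "l < n" and p: "prime p" and \<tau>: "\<tau> \<ge> 0"
  defines "P \<equiv> Pi_pmf {..<n} (0\<^sub>v n) (\<lambda>_. pmf_of_set (balanced_vecs n))"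
  shows "measure_pmf.prob P {x. int p dvd sum (kernel_mod p n l (\<lambda>i. ones n (x i))) (ones n (x l))}
    \<le> (\<Sum>a\<in>bad_vecs p n \<tau>. rho p n a ^ (n - 1)) + \<tau>"
proof -
  let ?D = "pmf_of_set (balanced_vecs n)"
  let ?k = "\<lambda>x. kernel_mod p n l (\<lambda>i. ones n (x i))"
  let ?H = "\<lambda>a. {x. \<forall>i<n. i \<noteq> l \<longrightarrow> int p dvd sum a (ones n (x i))}"
  let ?G = "{x. rho p n (?k x) < \<tau> \<and> int p dvd sum (?k x) (ones n (x l))}"
  have ones: "ones n v \<subseteq> {..<n}" for v by (auto simp: ones_def)
  have finb: "finite (bad_vecs p n \<tau>)"
    by (rule finite_subset[of _ "{..<n} \<rightarrow>\<^sub>E {0..<int p}"]) (auto simp: bad_vecs_def intro!: finite_PiE)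
  have "{x. int p dvd sum (?k x) (ones n (x l))} \<subseteq> (\<Union>a\<in>bad_vecs p n \<tau>. ?H a) \<union> ?G"
  proof
    fix x assume x: "x \<in> {x. int p dvd sum (?k x) (ones n (x l))}"
    show "x \<in> (\<Union>a\<in>bad_vecs p n \<tau>. ?H a) \<union> ?G"
    proof (cases "rho p n (?k x) < \<tau>")
      case False
      then have "?k x \<in> bad_vecs p n \<tau>"
        using kernel_mod(1,2)[of n "\<lambda>i. ones n (x i)" l p] ones l p by (auto simp: bad_vecs_def)
      moreover have "x \<in> ?H (?k x)"
        using kernel_mod(3)[of n "\<lambda>i. ones n (x i)" l p] ones l p by auto
      ultimately show ?thesis by blast
    qed (use x in auto)
  qed
  then have "measure_pmf.prob P {x. int p dvd sum (?k x) (ones n (x l))} \<le>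
      measure_pmf.prob P ((\<Union>a\<in>bad_vecs p n \<tau>. ?H a) \<union> ?G)"
    by (intro measure_pmf.finite_measure_mono) auto
  also have "\<dots> \<le> measure_pmf.prob P (\<Union>a\<in>bad_vecs p n \<tau>. ?H a) + measure_pmf.prob P ?G"
    by (intro measure_Un_le) auto
  also have "measure_pmf.prob P (\<Union>a\<in>bad_vecs p n \<tau>. ?H a) \<le> (\<Sum>a\<in>bad_vecs p n \<tau>. measure_pmf.prob P (?H a))"
    by (intro measure_UNION_le finb) auto
  also have "\<dots> = (\<Sum>a\<in>bad_vecs p n \<tau>. rho p n a ^ (n - 1))"
  proof (intro sum.cong refl)
    fix a
    \<comment> \<open>Row \<open>l\<close> is left unconstrained, whence the exponent
      \<open>n - 1\<close>.\<close>
    let ?B = "\<lambda>i. if i = l then UNIV else {v. int p dvd sum a (ones n v)}"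
    have "?H a = Pi {..<n} ?B" by (auto simp: Pi_def)
    then have "measure_pmf.prob P (?H a) = (\<Prod>i<n. measure_pmf.prob ?D (?B i))"
      unfolding P_def by (simp add: measure_Pi_pmf_Pi)
    also have "\<dots> = (\<Prod>i<n. if i = l then 1 else rho p n a)"
      by (intro prod.cong refl) (simp add: prob_balanced_eq_rho[OF n])
    also have "\<dots> = (\<Prod>i\<in>{..<n} - {l}. rho p n a)"
      using l by (intro prod.mono_neutral_cong_right) auto
    also have "\<dots> = rho p n a ^ (n - 1)" using l by simp
    finally show "measure_pmf.prob P (?H a) = rho p n a ^ (n - 1)" .
  qed
  also have "measure_pmf.prob P ?G \<le> \<tau>"
  proof -
    let ?c = "{..<n} - {l}"
    let ?R = "Pi_pmf ?c (0\<^sub>v n) (\<lambda>_. ?D)"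
    have ins: "{..<n} = insert l ?c" using l by auto
    \<comment> \<open>Row \<open>l\<close> is to be drawn last: once the other rows \<open>f\<close>
      are fixed, the kernel vector is fixed as well, and the event concerns a single uniform
      row.\<close>
    have "P = bind_pmf ?D (\<lambda>y. bind_pmf ?R (\<lambda>f. return_pmf (f(l := y))))"
      unfolding P_def by (subst ins, subst Pi_pmf_insert') auto
    also have "\<dots> = bind_pmf ?R (\<lambda>f. bind_pmf ?D (\<lambda>y. return_pmf (f(l := y))))"
      by (rule bind_commute_pmf)
    also have "\<dots> = bind_pmf ?R (\<lambda>f. map_pmf (\<lambda>y. f(l := y)) ?D)" by (simp add: map_pmf_def)
    finally have P: "P = bind_pmf ?R (\<lambda>f. map_pmf (\<lambda>y. f(l := y)) ?D)" .
    have "emeasure P ?G = (\<integral>\<^sup>+f. emeasure (map_pmf (\<lambda>y. f(l := y)) ?D) ?G \<partial>?R)"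
      unfolding P by (rule emeasure_bind_pmf)
    also have "\<dots> \<le> (\<integral>\<^sup>+f. ennreal \<tau> \<partial>?R)"
    proof (intro nn_integral_mono)
      fix f
      have k: "?k (f(l := y)) = ?k f" for y by (rule kernel_mod_cong) simp
      have "measure_pmf.prob (map_pmf (\<lambda>y. f(l := y)) ?D) ?G = measure_pmf.prob ?D {y. f(l := y) \<in> ?G}"
        by (simp add: vimage_def)
      also have "{y. f(l := y) \<in> ?G} = {y. rho p n (?k f) < \<tau> \<and> int p dvd sum (?k f) (ones n y)}"
        by (simp only: mem_Collect_eq k fun_upd_same)
      also have "measure_pmf.prob ?D \<dots> \<le> \<tau>"
      proof (cases "rho p n (?k f) < \<tau>")
        case True
        then show ?thesis by (simp add: prob_balanced_eq_rho[OF n] less_imp_le)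
      qed (use \<tau> in simp)
      finally show "emeasure (map_pmf (\<lambda>y. f(l := y)) ?D) ?G \<le> ennreal \<tau>"
        unfolding measure_pmf.emeasure_eq_measure by (rule ennreal_leI)
    qed
    also have "\<dots> = ennreal \<tau>" by simp
    finally show ?thesis using \<tau> by (simp add: measure_pmf.emeasure_eq_measure)
  qed
  finally show ?thesis by simp
qed

lemma prob_singular_le:
  fixes \<tau> :: real
  assumes n: "even n" and p: "prime p" and \<tau>: "\<tau> \<ge> 0"
  shows "measure_pmf.prob (random_balanced_matrix n) {Q. \<not> invertible_mat Q}
    \<le> real n * ((\<Sum>a\<in>bad_vecs p n \<tau>. rho p n a ^ (n - 1)) + \<tau>)"
proof -
  define P where "P = Pi_pmf {..<n} (0\<^sub>v n) (\<lambda>_. pmf_of_set (balanced_vecs n))"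
  let ?F = "\<lambda>l. {x. int p dvd sum (kernel_mod p n l (\<lambda>i. ones n (x i))) (ones n (x l))}"
  have supp: "x i \<in> balanced_vecs n" if "x \<in> set_pmf P" "i < n" for x i
    using that unfolding P_def
    by (auto simp: set_Pi_pmf PiE_dflt_def finite_balanced_vecs balanced_vecs_nonempty)
  have "measure_pmf.prob (random_balanced_matrix n) {Q. \<not> invertible_mat Q} =
      measure_pmf.prob P {x. \<not> invertible_mat (mat\<^sub>r n n x)}"
    by (simp add: random_balanced_matrix_def P_def vimage_def)
  \<comment> \<open>Only on the support are the rows known to be balanced.\<close>
  also have "\<dots> = measure_pmf.prob P ({x. \<not> invertible_mat (mat\<^sub>r n n x)} \<inter> set_pmf P)"
    by (simp add: measure_Int_set_pmf)
  also have "\<dots> \<le> measure_pmf.prob P (\<Union>l\<in>{..<n}. ?F l)"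
    using singular_imp_dependent_row[OF supp _ p]
    by (intro measure_pmf.finite_measure_mono) fastforce+
  also have "\<dots> \<le> (\<Sum>l<n. measure_pmf.prob P (?F l))"
    by (intro measure_UNION_le) auto
  also have "\<dots> \<le> (\<Sum>l<n. (\<Sum>a\<in>bad_vecs p n \<tau>. rho p n a ^ (n - 1)) + \<tau>)"
    unfolding P_def by (intro sum_mono prob_dependent_row_le n p \<tau>) auto
  finally show ?thesis by simp
qed

theorem theorem1p3:
  shows "\<forall>C::real. C > 0 \<longrightarrow>
    (\<exists>K::real. \<forall>n::nat. n > 0 \<and> even n \<longrightarrow>
       measure_pmf.prob (random_balanced_matrix n) {Q. \<not> invertible_mat Q}
         \<le> K * real n powr (- C))"
proof (intro allI impI)
  fix C :: real assume C: "C > 0"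
  \<comment> \<open>The extra 1 compensates for the factor \<open>n\<close> from the union over the
    rows \<open>l\<close> in \<open>prob_singular_le\<close>; rounding up supplies the natural
    exponent required above.\<close>
  define C' where "C' = nat \<lceil>C\<rceil> + 1"
  have C': "real C' \<ge> C + 1" unfolding C'_def by linarith
  from eventually_sum_bad_vecs_le[of C'] obtain N where N: "\<And>n. n \<ge> N \<Longrightarrow> even n \<Longrightarrow> \<exists>p. prime p \<and>
      (\<Sum>a\<in>bad_vecs p n (real n powr (- real C')). rho p n a ^ (n - 1)) \<le> real n powr (- real C')"
    unfolding eventually_sequentially by blast
  show "\<exists>K::real. \<forall>n::nat. n > 0 \<and> even n \<longrightarrow>
       measure_pmf.prob (random_balanced_matrix n) {Q. \<not> invertible_mat Q} \<le> K * real n powr (- C)"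
  proof (intro exI allI impI)
    fix n :: nat assume n: "n > 0 \<and> even n"
    let ?P = "measure_pmf.prob (random_balanced_matrix n) {Q. \<not> invertible_mat Q}"
    let ?\<tau> = "real n powr (- real C')"
    \<comment> \<open>The constant 2 serves all \<open>n \<ge> N\<close>; for smaller
      \<open>n\<close> the trivial bound 1 suffices, since
      \<open>N^C * n^(-C) \<ge> 1\<close>.\<close>
    show "?P \<le> (2 + real N powr C) * real n powr (- C)"
    proof (cases "n \<ge> N")
      case True
      then obtain p where p: "prime p" "(\<Sum>a\<in>bad_vecs p n ?\<tau>. rho p n a ^ (n - 1)) \<le> ?\<tau>"
        using N n by blast
      have "?P \<le> real n * ((\<Sum>a\<in>bad_vecs p n ?\<tau>. rho p n a ^ (n - 1)) + ?\<tau>)"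
        using n p by (intro prob_singular_le) auto
      also have "\<dots> \<le> real n * (?\<tau> + ?\<tau>)" using p by (intro mult_left_mono add_right_mono) auto
      also have "\<dots> = 2 * (real n powr 1 * ?\<tau>)" by simp
      also have "\<dots> = 2 * real n powr (1 + - real C')" unfolding powr_add by simp
      also have "\<dots> \<le> 2 * real n powr (- C)"
        using C' n by (intro mult_left_mono powr_mono) auto
      also have "\<dots> \<le> (2 + real N powr C) * real n powr (- C)" by (intro mult_right_mono) auto
      finally show ?thesis .
    next
      case False
      have "?P \<le> 1" by (rule measure_pmf.prob_le_1)
      also have "1 = real n powr C * real n powr (- C)" using n by (simp flip: powr_add)
      also have "\<dots> \<le> (2 + real N powr C) * real n powr (- C)"
        using False C powr_mono2[of C "real n" "real N"] by (intro mult_right_mono) auto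
      finally show ?thesis .
    qed
  qed
qed

end
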